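(* Let $n\ge 3$. The pentagram invariants $O_1,\dots,O_{\lfloor n/2\rfloor},O_n,E_1,\dots,E_{\lfloor n/2\rfloor},E_n$, polynomials in $x_1,\dots,x_{2n}$, are algebraically independent over $\mathbb{C}$. Consequently the rational map $\alpha=\alpha_1\circ\alpha_2$ has at least $2\lfloor n/2\rfloor+2$ algebraically independent polynomial invariants, i.e. there are at least $2\lfloor n/2\rfloor+2$ algebraically independent polynomials $f$ in $x_1,\dots,x_{2n}$ with $f\circ\alpha=f$.
   Context: All indices are taken mod $2n$. The map $\alpha_1(x_1,\dots,x_{2n})=(x_1',\dots,x_{2n}')$ is $$x_{2k-1}'=x_{2k}\frac{1-x_{2k+1}x_{2k+2}}{1-x_{2k-3}x_{2k-2}},\qquad x_{2k}'=x_{2k-1}\frac{1-x_{2k-3}x_{2k-2}}{1-x_{2k+1}x_{2k+2}},$$ and $\alpha_2(x_1,\dots,x_{2n})=(x_1'',\dots,x_{2n}'')$ is $$x_{2k+1}''=x_{2k}\frac{1-x_{2k-2}x_{2k-1}}{1-x_{2k+2}x_{2k+3}},\qquad x_{2k}''=x_{2k+1}\frac{1-x_{2k+2}x_{2k+3}}{1-x_{2k-2}x_{2k-1}}.$$ Pentagram invariants. Indices lie in $\{1,\dots,2n\}$, taken cyclically mod $2n$. An odd unit is a set $\{j\}$ with $j$ odd, or $\{k-1,k,k+1\}$ with $k$ even. Two odd units are consecutive if the odd numbers in their union form a set of (cyclically) consecutive odd numbers. An odd admissible subset $S$ is a nonempty union of odd units no two of which are consecutive; its weight is the number of its units, and $\mathrm{sign}(S)=+1$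 or $-1$ according to whether the number of singleton units is even or odd. For $1\le k\le\lfloor n/2\rfloor$, $O_k=\sum_S \mathrm{sign}(S)\prod_{j\in S}x_j$ over odd admissible $S$ of weight $k$; also $O_n=x_1x_3\cdots x_{2n-1}$. The $E_k$ are defined in the same way with the words odd and even interchanged ($E_n=x_2x_4\cdots x_{2n}$). *)

theory Defs
  imports
    Complex_Main
    "HOL-Library.Poly_Mapping"
    "HOL-Computational_Algebra.Polynomial_Factorial"
begin

subsection \<open>Complex polynomials in variables indexed by a type\<close>

type_synonym 'i cpoly = "('i \<Rightarrow>\<^sub>0 nat) \<Rightarrow>\<^sub>0 complex"

definition Const :: "complex \<Rightarrow> 'i cpoly" where
  "Const c = Poly_Mapping.single 0 c"

definition Var :: "'i \<Rightarrow> 'i cpoly" where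
  "Var i = Poly_Mapping.single (Poly_Mapping.single i 1) 1"

definition polys_in :: "'i set \<Rightarrow> 'i cpoly set" where
  "polys_in I = {P. \<forall>m\<in>Poly_Mapping.keys P. Poly_Mapping.keys m \<subseteq> I}"

text \<open>\<open>subst h v P\<close> is the value of \<open>P\<close> at \<open>v\<close>, the coefficients being mapped by \<open>h\<close>.\<close>

definition subst :: "(complex \<Rightarrow> 'b::comm_ring_1) \<Rightarrow> ('i \<Rightarrow> 'b) \<Rightarrow> 'i cpoly \<Rightarrow> 'b" where
  "subst h v P =
     (\<Sum>m\<in>Poly_Mapping.keys P.
        h (Poly_Mapping.lookup P m) * (\<Prod>i\<in>Poly_Mapping.keys m. v i ^ Poly_Mapping.lookup m i))"

text \<open>
  Algebraic independence over the complex numbers of the family \<open>(f i)\<close>, \<open>i \<in> I\<close>; in particular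
  the \<open>f i\<close> are then pairwise distinct.
\<close>

definition alg_independent :: "'i set \<Rightarrow> ('i \<Rightarrow> 'j cpoly) \<Rightarrow> bool" where
  "alg_independent I f \<longleftrightarrow> (\<forall>P\<in>polys_in I. subst Const f P = 0 \<longrightarrow> P = 0)"


subsection \<open>The rational maps\<close>

text \<open>Indices are integers; \<open>cyc n j\<close> is the representative of \<open>j\<close> modulo \<open>2n\<close> in \<open>{1..2n}\<close>.\<close>

definition cyc :: "nat \<Rightarrow> int \<Rightarrow> int" where
  "cyc n j = (j - 1) mod (2 * int n) + 1"

definition alpha1 :: "nat \<Rightarrow> (int \<Rightarrow> 'a::field) \<Rightarrow> int \<Rightarrow> 'a" where
  "alpha1 n x j =
     (let y = (\<lambda>i. x (cyc n i)) in
      if odd j then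
        (let k = (j + 1) div 2 in
         y (2*k) * ((1 - y (2*k+1) * y (2*k+2)) / (1 - y (2*k-3) * y (2*k-2))))
      else
        (let k = j div 2 in
         y (2*k-1) * ((1 - y (2*k-3) * y (2*k-2)) / (1 - y (2*k+1) * y (2*k+2)))))"

definition alpha2 :: "nat \<Rightarrow> (int \<Rightarrow> 'a::field) \<Rightarrow> int \<Rightarrow> 'a" where
  "alpha2 n x j =
     (let y = (\<lambda>i. x (cyc n i)) in
      if odd j then
        (let k = (j - 1) div 2 in
         y (2*k) * ((1 - y (2*k-2) * y (2*k-1)) / (1 - y (2*k+2) * y (2*k+3))))
      else
        (let k = j div 2 in
         y (2*k+1) * ((1 - y (2*k+2) * y (2*k+3)) / (1 - y (2*k-2) * y (2*k-1)))))"

definition alpha :: "nat \<Rightarrow> (int \<Rightarrow> 'a::field) \<Rightarrow> int \<Rightarrow> 'a" where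
  "alpha n = alpha1 n \<circ> alpha2 n"

text \<open>
  The identity \<open>f \<circ> \<alpha> = f\<close> between rational functions is stated in the field of fractions of the
  polynomial ring, by applying \<open>alpha\<close> to the generic point. No denominator that occurs is the zero
  rational function: each of them takes the value 1 at the origin, which \<open>alpha2\<close> fixes.
\<close>

definition generic_point :: "int \<Rightarrow> int cpoly fract" where
  "generic_point j = to_fract (Var j)"

definition alpha_invariant :: "nat \<Rightarrow> int cpoly \<Rightarrow> bool" where
  "alpha_invariant n f \<longleftrightarrow>
     subst (\<lambda>c. to_fract (Const c)) (alpha n generic_point) f = to_fract f"


subsection \<open>The pentagram invariants\<close>

text \<open>
  The parity \<open>p\<close> is \<open>odd\<close> for the \<open>O\<close>-invariants and \<open>even\<close> for the \<open>E\<close>-invariants.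
\<close>

definition units :: "nat \<Rightarrow> (int \<Rightarrow> bool) \<Rightarrow> int set set" where
  "units n p =
     {{j} | j. j \<in> {1..2 * int n} \<and> p j} \<union>
     {{cyc n (k - 1), k, cyc n (k + 1)} | k. k \<in> {1..2 * int n} \<and> \<not> p k}"

text \<open>The cyclic intervals \<open>{a, a + 2, ..., a + 2(m - 1)}\<close> modulo \<open>2n\<close> of indices of parity \<open>p\<close>.\<close>

definition cyclic_run :: "nat \<Rightarrow> (int \<Rightarrow> bool) \<Rightarrow> int set \<Rightarrow> bool" where
  "cyclic_run n p T \<longleftrightarrow> (\<exists>a m. p a \<and> T = (\<lambda>i. cyc n (a + 2 * int i)) ` {..<m})"

definition consecutive :: "nat \<Rightarrow> (int \<Rightarrow> bool) \<Rightarrow> int set \<Rightarrow> int set \<Rightarrow> bool" where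
  "consecutive n p U V \<longleftrightarrow> cyclic_run n p {j \<in> U \<union> V. p j}"

definition unit_decomposition ::
    "nat \<Rightarrow> (int \<Rightarrow> bool) \<Rightarrow> int set set \<Rightarrow> int set \<Rightarrow> bool" where
  "unit_decomposition n p F S \<longleftrightarrow>
     F \<noteq> {} \<and> F \<subseteq> units n p \<and> S = \<Union>F \<and>
     (\<forall>U\<in>F. \<forall>V\<in>F. U \<noteq> V \<longrightarrow> \<not> consecutive n p U V)"

definition admissible :: "nat \<Rightarrow> (int \<Rightarrow> bool) \<Rightarrow> int set \<Rightarrow> bool" where
  "admissible n p S \<longleftrightarrow> (\<exists>F. unit_decomposition n p F S)"

text \<open>The decomposition is unique, see \<open>units_of_eq\<close> below.\<close>

definition units_of :: "nat \<Rightarrow> (int \<Rightarrow> bool) \<Rightarrow> int set \<Rightarrow> int set set" where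
  "units_of n p S = (THE F. unit_decomposition n p F S)"

definition weight :: "nat \<Rightarrow> (int \<Rightarrow> bool) \<Rightarrow> int set \<Rightarrow> nat" where
  "weight n p S = card (units_of n p S)"

definition sign :: "nat \<Rightarrow> (int \<Rightarrow> bool) \<Rightarrow> int set \<Rightarrow> int" where
  "sign n p S = (if even (card {U \<in> units_of n p S. is_singleton U}) then 1 else - 1)"

definition pentagram_inv :: "nat \<Rightarrow> (int \<Rightarrow> bool) \<Rightarrow> nat \<Rightarrow> int cpoly" where
  "pentagram_inv n p k =
     (if k = n then \<Prod>j\<in>{j \<in> {1..2 * int n}. p j}. Var j
      else \<Sum>S\<in>{S. admissible n p S \<and> weight n p S = k}. of_int (sign n p S) * (\<Prod>j\<in>S. Var j))"

abbreviation pentagram_O :: "nat \<Rightarrow> nat \<Rightarrow> int cpoly" where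
  "pentagram_O n \<equiv> pentagram_inv n odd"

abbreviation pentagram_E :: "nat \<Rightarrow> nat \<Rightarrow> int cpoly" where
  "pentagram_E n \<equiv> pentagram_inv n even"

definition inv_indices :: "nat \<Rightarrow> nat set" where
  "inv_indices n = {1..n div 2} \<union> {n}"


subsection \<open>Uniqueness of the decomposition into units\<close>

lemma even_cyc: "even (cyc n j) \<longleftrightarrow> even j"
proof -
  have "even ((j - 1) mod (2 * int n)) \<longleftrightarrow> even (j - 1)"
    by (simp add: dvd_mod_iff)
  then show ?thesis by (simp add: cyc_def)
qed

lemma cyc_id: "j \<in> {1..2 * int n} \<Longrightarrow> cyc n j = j"
  by (simp add: cyc_def)

lemma triple_in_decomposition:
  assumes p: "p = odd \<or> p = even"
    and F: "unit_decomposition n p F S"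
    and k: "k \<in> {1..2 * int n}" "\<not> p k" "k \<in> S"
  shows "{cyc n (k - 1), k, cyc n (k + 1)} \<in> F"
proof -
  obtain V where V: "V \<in> F" "k \<in> V"
    using F k by (auto simp: unit_decomposition_def)
  then have "V \<in> units n p"
    using F by (auto simp: unit_decomposition_def)
  then obtain l where l: "\<not> p l" "V = {cyc n (l - 1), l, cyc n (l + 1)}"
    using V k by (auto simp: units_def)
  have "k = l"
    using V(2) l k(2) p even_cyc[of n "l - 1"] even_cyc[of n "l + 1"] by auto
  then show ?thesis using V(1) l by simp
qed

lemma consecutive_triple:
  assumes p: "p = odd \<or> p = even" and k: "\<not> p k"
    and j: "j \<in> {cyc n (k - 1), cyc n (k + 1)}"
  shows "consecutive n p {j} {cyc n (k - 1), k, cyc n (k + 1)}"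
proof -
  have pk: "p (k - 1)" "p (cyc n (k - 1))" "p (cyc n (k + 1))"
    using p k even_cyc[of n "k - 1"] even_cyc[of n "k + 1"] by auto
  have "{i \<in> {j} \<union> {cyc n (k - 1), k, cyc n (k + 1)}. p i} = {cyc n (k - 1), cyc n (k + 1)}"
    using pk k j by auto
  also have "\<dots> = (\<lambda>i. cyc n ((k - 1) + 2 * int i)) ` {..<2}"
    by (auto simp: numeral_2_eq_2 lessThan_Suc add.commute)
  finally show ?thesis
    using pk(1) unfolding consecutive_def cyclic_run_def by blast
qed

lemma unit_decomposition_subset:
  assumes p: "p = odd \<or> p = even"
    and F: "unit_decomposition n p F S" and G: "unit_decomposition n p G S"
  shows "F \<subseteq> G"
proof
  fix U assume U: "U \<in> F"
  then have "U \<in> units n p" "U \<subseteq> S"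
    using F by (auto simp: unit_decomposition_def)
  then consider
      (single) j where "j \<in> {1..2 * int n}" "p j" "U = {j}"
    | (triple) k where "k \<in> {1..2 * int n}" "\<not> p k" "U = {cyc n (k - 1), k, cyc n (k + 1)}"
    by (auto simp: units_def)
  then show "U \<in> G"
  proof cases
    case triple
    then show ?thesis
      using triple_in_decomposition[OF p G, of k] \<open>U \<subseteq> S\<close> by auto
  next
    case single
    obtain V where V: "V \<in> G" "j \<in> V"
      using \<open>U \<subseteq> S\<close> single G by (auto simp: unit_decomposition_def)
    then have "V \<in> units n p" "V \<subseteq> S"
      using G by (auto simp: unit_decomposition_def)
    then consider
        (s) i where "V = {i}"
      | (t) k where "k \<in> {1..2 * int n}" "\<not> p k" "V = {cyc n (k - 1), k, cyc n (k + 1)}"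
      by (auto simp: units_def)
    then show ?thesis
    proof cases
      case s
      then show ?thesis using V single by auto
    next
      case t
      have "V \<in> F"
        using triple_in_decomposition[OF p F, of k] t \<open>V \<subseteq> S\<close> by auto
      moreover have "j \<in> {cyc n (k - 1), cyc n (k + 1)}"
        using V t single by auto
      then have "consecutive n p U V"
        using consecutive_triple[OF p] t single by blast
      moreover have "U \<noteq> V"
        using single t by auto
      ultimately show ?thesis
        using F U by (auto simp: unit_decomposition_def)
    qed
  qed
qed

lemma units_of_eq:
  assumes "p = odd \<or> p = even" and "unit_decomposition n p F S"
  shows "units_of n p S = F"
  unfolding units_of_def
  using assms unit_decomposition_subset by (intro the_equality) blast+

end

theory Submission
  imports Defs
begin

text \<open>
  Give each unit a mark, namely its element \<open>j\<close> of parity \<open>p\<close> for a singleton and its last such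
  element for a triple \<open>{j - 2, j - 1, j}\<close>. Units are pairwise non-consecutive iff no two marks differ
  by 2 and a mark \<open>j\<close> carries a triple only if \<open>j - 4\<close> is no mark. Summing over the triples first gives
  \[ (-1)^k \sum_M \prod_{j \in M} x_j \prod_{j \in M,\ j - 4 \notin M} (1 - x_{j-2} x_{j-1}), \]
  and, with triples \<open>{j, j + 1, j + 2}\<close> instead, the mirror image of this formula. The substitutions
  \<open>alpha1\<close> and \<open>alpha2\<close> take the summands of one formula for \<open>O\<^sub>k\<close> to those of the mirrored formula
  for \<open>E\<^sub>k\<close> and vice versa, so each of them swaps \<open>O\<^sub>k\<close> and \<open>E\<^sub>k\<close>.

  For the independence, put \<open>x\<^sub>j = T\<^bsup>w j\<^esup>\<close>. If \<open>w\<close> is smallest and increasing on \<open>1, 5, 9, \<dots>\<close> among the odd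
  indices, then the lowest term of \<open>O\<^sub>k\<close> comes from \<open>M = {1, 5, \<dots>, 4k - 3}\<close> alone; similarly for \<open>E\<^sub>k\<close>.
  The orders in \<open>T\<close> of the invariants can thus be made different powers of a large \<open>B\<close>, and
  then different monomials in the invariants have different orders.
\<close>

subsection \<open>Substitution into polynomials\<close>

locale unital_hom =
  fixes h :: "'a::comm_ring_1 \<Rightarrow> 'b::comm_ring_1"
  assumes one [simp]: "h 1 = 1"
    and add: "h (a + b) = h a + h b"
    and mult: "h (a * b) = h a * h b"
begin

lemma zero [simp]: "h 0 = 0"
  using add[of 0 0] by simp

lemma uminus: "h (- a) = - h a"
  using add[of a "- a"] by (simp add: eq_neg_iff_add_eq_0 add.commute)

lemma diff: "h (a - b) = h a - h b"
  using add[of a "- b"] by (simp add: uminus)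

lemma sum: "h (sum f A) = (\<Sum>x\<in>A. h (f x))"
  by (induction A rule: infinite_finite_induct) (simp_all add: add)

lemma prod: "h (prod f A) = (\<Prod>x\<in>A. h (f x))"
  by (induction A rule: infinite_finite_induct) (simp_all add: mult)

lemma power: "h (a ^ k) = h a ^ k"
  by (induction k) (simp_all add: mult)

end

definition monomial_value :: "('i \<Rightarrow> 'b::comm_ring_1) \<Rightarrow> ('i \<Rightarrow>\<^sub>0 nat) \<Rightarrow> 'b" where
  "monomial_value v m = (\<Prod>i\<in>Poly_Mapping.keys m. v i ^ Poly_Mapping.lookup m i)"

lemma monomial_value_superset:
  assumes "finite K" "Poly_Mapping.keys m \<subseteq> K"
  shows "monomial_value v m = (\<Prod>i\<in>K. v i ^ Poly_Mapping.lookup m i)"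
  unfolding monomial_value_def
  by (rule prod.mono_neutral_left) (use assms in \<open>auto simp: in_keys_iff\<close>)

lemma monomial_value_add: "monomial_value v (m + m') = monomial_value v m * monomial_value v m'"
proof -
  let ?K = "Poly_Mapping.keys m \<union> Poly_Mapping.keys m'"
  have "monomial_value v (m + m') = (\<Prod>i\<in>?K. v i ^ Poly_Mapping.lookup (m + m') i)"
    by (rule monomial_value_superset) (use Poly_Mapping.keys_add[of m m'] in auto)
  then show ?thesis
    by (simp add: lookup_add power_add prod.distrib monomial_value_superset[of ?K])
qed

lemma monomial_value_0 [simp]: "monomial_value v 0 = 1"
  by (simp add: monomial_value_def)

lemma monomial_value_single [simp]: "monomial_value v (Poly_Mapping.single i k) = v i ^ k"
  by (cases "k = 0") (simp_all add: monomial_value_def)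

lemma sum_monomials:
  fixes P :: "'m \<Rightarrow>\<^sub>0 'c::comm_monoid_add"
  shows "P = (\<Sum>m\<in>Poly_Mapping.keys P. Poly_Mapping.single m (Poly_Mapping.lookup P m))"
  by (rule poly_mapping_eqI)
     (auto simp: lookup_sum lookup_single when_def in_keys_iff sum.delta)

context unital_hom
begin

lemma monomial_value: "h (monomial_value v m) = monomial_value (\<lambda>i. h (v i)) m"
  by (simp add: monomial_value_def prod power)

end

lemma subst_monomial_value:
  "subst h v P = (\<Sum>m\<in>Poly_Mapping.keys P. h (Poly_Mapping.lookup P m) * monomial_value v m)"
  by (simp add: subst_def monomial_value_def)

locale coeff_hom = unital_hom h for h :: "complex \<Rightarrow> 'b::comm_ring_1"
begin

lemma subst_superset:
  assumes "finite K" "Poly_Mapping.keys P \<subseteq> K"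
  shows "subst h v P = (\<Sum>m\<in>K. h (Poly_Mapping.lookup P m) * monomial_value v m)"
  unfolding subst_monomial_value
  by (rule sum.mono_neutral_left) (use assms in \<open>auto simp: in_keys_iff\<close>)

lemma subst_add: "subst h v (P + Q) = subst h v P + subst h v Q"
proof -
  let ?K = "Poly_Mapping.keys P \<union> Poly_Mapping.keys Q"
  have "subst h v (P + Q) = (\<Sum>m\<in>?K. h (Poly_Mapping.lookup (P + Q) m) * monomial_value v m)"
    by (rule subst_superset) (use Poly_Mapping.keys_add[of P Q] in auto)
  then show ?thesis
    by (simp add: lookup_add add distrib_right sum.distrib subst_superset[of ?K])
qed

lemma subst_0 [simp]: "subst h v 0 = 0"
  by (simp add: subst_def)

lemma subst_sum: "subst h v (sum f A) = (\<Sum>x\<in>A. subst h v (f x))"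
  by (induction A rule: infinite_finite_induct) (simp_all add: subst_add)

lemma subst_single: "subst h v (Poly_Mapping.single m c) = h c * monomial_value v m"
  by (cases "c = 0") (simp_all add: subst_monomial_value)

text \<open>Both factors are split into monomials, so that only \<open>monomial_value_add\<close> is
  needed.\<close>

lemma subst_mult: "subst h v (P * Q) = subst h v P * subst h v Q"
proof -
  let ?s = "\<lambda>P m. Poly_Mapping.single m (Poly_Mapping.lookup P m)"
  have "P * Q = (\<Sum>m\<in>Poly_Mapping.keys P. \<Sum>k\<in>Poly_Mapping.keys Q. ?s P m * ?s Q k)"
    unfolding sum_product[symmetric] by (simp flip: sum_monomials)
  then have "subst h v (P * Q) =
      (\<Sum>m\<in>Poly_Mapping.keys P. \<Sum>k\<in>Poly_Mapping.keys Q. subst h v (?s P m) * subst h v (?s Q k))"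
    by (simp add: subst_sum mult_single subst_single mult monomial_value_add mult_ac)
  also have "\<dots> = subst h v P * subst h v Q"
    unfolding subst_monomial_value[of h v P] subst_monomial_value[of h v Q]
    by (simp add: sum_product subst_single)
  finally show ?thesis .
qed

lemma subst_Const [simp]: "subst h v (Const c) = h c"
  by (simp add: Const_def subst_single)

lemma subst_Var [simp]: "subst h v (Var i) = v i"
  by (simp add: Var_def subst_single)

sublocale subst: unital_hom "subst h v"
  by unfold_locales
     (simp_all add: subst_add subst_mult subst_single monomial_value_0 flip: single_one)

end

text \<open>With a substitution for \<open>h\<close> this composes substitutions; with
  \<open>to_fract\<close> it carries a value into the field of fractions. Both uses occur
  below.\<close>

lemma (in unital_hom) hom_subst:
  "h (subst g v P) = subst (\<lambda>c. h (g c)) (\<lambda>i. h (v i)) P"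
  by (simp add: subst_monomial_value sum mult monomial_value)

lemma coeff_hom_Const: "coeff_hom Const"
  by unfold_locales (simp_all add: Const_def single_add mult_single)

lemma subst_Const_Var [simp]: "subst Const Var P = P"
proof -
  have *: "monomial_value Var m = Poly_Mapping.single m 1" for m :: "'a \<Rightarrow>\<^sub>0 nat"
  proof -
    have pw: "Var i ^ k = Poly_Mapping.single (Poly_Mapping.single i k) (1::complex)" for i :: 'a and k
      by (induction k) (simp_all add: Var_def mult_single add.commute flip: single_add)
    have "finite A \<Longrightarrow> (\<Prod>i\<in>A. Var i ^ Poly_Mapping.lookup m i) =
        Poly_Mapping.single (\<Sum>i\<in>A. Poly_Mapping.single i (Poly_Mapping.lookup m i)) (1::complex)" for A
      by (induction A rule: finite_induct) (simp_all add: pw mult_single)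
    then show ?thesis
      by (simp add: monomial_value_def flip: sum_monomials)
  qed
  show ?thesis
    unfolding subst_monomial_value
    by (subst (3) sum_monomials) (simp add: * Const_def mult_single)
qed

subsection \<open>Algebraic independence\<close>

lemma polys_in_Var: "i \<in> I \<Longrightarrow> Var i \<in> polys_in I"
  by (simp add: polys_in_def Var_def)

lemma polys_in_0: "0 \<in> polys_in I"
  by (simp add: polys_in_def)

lemma polys_in_Const: "Const c \<in> polys_in I"
  by (auto simp: polys_in_def Const_def)

lemma polys_in_1: "1 \<in> polys_in I"
  by (auto simp: polys_in_def)

lemma polys_in_uminus: "P \<in> polys_in I \<Longrightarrow> - P \<in> polys_in I"
  by (simp add: polys_in_def in_keys_iff)

lemma polys_in_add: "P \<in> polys_in I \<Longrightarrow> Q \<in> polys_in I \<Longrightarrow> P + Q \<in> polys_in I"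
  using Poly_Mapping.keys_add[of P Q] by (auto simp: polys_in_def)

lemma polys_in_mult:
  assumes "P \<in> polys_in I" "Q \<in> polys_in I" shows "P * Q \<in> polys_in I"
  unfolding polys_in_def
proof (intro CollectI ballI)
  fix m assume "m \<in> Poly_Mapping.keys (P * Q)"
  then obtain a b where "m = a + b" "a \<in> Poly_Mapping.keys P" "b \<in> Poly_Mapping.keys Q"
    using keys_mult[of P Q] by auto
  then show "Poly_Mapping.keys m \<subseteq> I"
    using assms Poly_Mapping.keys_add[of a b] by (fastforce simp: polys_in_def)
qed

lemma polys_in_sum: "(\<And>x. x \<in> A \<Longrightarrow> f x \<in> polys_in I) \<Longrightarrow> sum f A \<in> polys_in I"
  by (induction A rule: infinite_finite_induct) (auto intro: polys_in_add polys_in_0)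

lemma polys_in_prod: "(\<And>x. x \<in> A \<Longrightarrow> f x \<in> polys_in I) \<Longrightarrow> prod f A \<in> polys_in I"
  by (induction A rule: infinite_finite_induct) (auto intro: polys_in_mult polys_in_1)

lemma polys_in_power: "P \<in> polys_in I \<Longrightarrow> P ^ k \<in> polys_in I"
  by (induction k) (auto intro: polys_in_mult polys_in_1)

lemma polys_in_subst_Const:
  assumes "P \<in> polys_in I" "\<And>i. i \<in> I \<Longrightarrow> v i \<in> polys_in J"
  shows "subst Const v P \<in> polys_in J"
  unfolding subst_def
  by (intro polys_in_sum polys_in_mult polys_in_Const polys_in_prod polys_in_power)
     (use assms in \<open>auto simp: polys_in_def[of I]\<close>)

text \<open>Two equal members would satisfy the relation \<open>Var i - Var j\<close>. The final
  count of invariants rests on this.\<close>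

lemma alg_independent_inj_on:
  fixes f :: "'i \<Rightarrow> 'j cpoly"
  assumes "alg_independent I f" shows "inj_on f I"
proof (rule inj_onI, rule ccontr)
  interpret coeff_hom "Const :: complex \<Rightarrow> 'j cpoly" by (rule coeff_hom_Const)
  fix i j assume ij: "i \<in> I" "j \<in> I" "f i = f j" "i \<noteq> j"
  let ?P = "Var i - Var j :: 'i cpoly"
  have "?P \<in> polys_in I"
    using polys_in_add[of "Var i" I "- Var j"] ij by (simp add: polys_in_Var polys_in_uminus)
  moreover have "subst Const f ?P = 0"
    using ij by (simp add: subst.diff)
  ultimately have "?P = 0"
    using assms unfolding alg_independent_def by blast
  then have "(Poly_Mapping.lookup ?P (Poly_Mapping.single i 1)) = 0"
    by simp
  moreover have "Poly_Mapping.single j 1 \<noteq> Poly_Mapping.single i (1::nat)"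
    using ij(4) by (metis lookup_single_eq lookup_single_not_eq zero_neq_one)
  ultimately show False
    by (simp add: Var_def lookup_minus lookup_single)
qed

text \<open>A set of polynomials is a family indexed by its own elements, so a relation
  \<open>P\<close> among them has polynomials as variables. Renaming each variable \<open>g\<close>
  to an index \<open>i\<close> with \<open>f i = g\<close> turns \<open>P\<close> into a relation of
  the original family.\<close>

lemma alg_independent_image:
  fixes f :: "'i \<Rightarrow> 'j cpoly"
  assumes ind: "alg_independent I f" shows "alg_independent (f ` I) (\<lambda>g. g)"
  unfolding alg_independent_def
proof (intro ballI impI)
  interpret cj: coeff_hom "Const :: complex \<Rightarrow> 'j cpoly" by (rule coeff_hom_Const)
  interpret cf: coeff_hom "Const :: complex \<Rightarrow> 'j cpoly cpoly" by (rule coeff_hom_Const)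
  fix P :: "'j cpoly cpoly"
  assume P: "P \<in> polys_in (f ` I)" "subst Const (\<lambda>g. g) P = 0"
  define r where "r = (\<lambda>g. Var (inv_into I f g) :: 'i cpoly)"
  \<comment> \<open>The value of \<open>P\<close> depends only on the variables that occur in it,
    and these lie in the image of \<open>I\<close>.\<close>
  have eq: "subst Const u P = subst Const v P"
    if "\<And>g. g \<in> f ` I \<Longrightarrow> u g = v g" for u v :: "'j cpoly \<Rightarrow> 'k cpoly"
    unfolding subst_def using P(1) that
    by (intro sum.cong prod.cong arg_cong2[of _ _ _ _ "(*)"] arg_cong2[of _ _ _ _ "(^)"] refl)
       (auto simp: polys_in_def)
  have "subst Const r P \<in> polys_in I"
    using P(1) by (rule polys_in_subst_Const) (auto simp: r_def intro: polys_in_Var inv_into_into)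
  moreover have "subst Const f (subst Const r P) = 0"
    using P(2) eq[of "\<lambda>g. f (inv_into I f g)" "\<lambda>g. g"]
    by (simp add: cj.subst.hom_subst r_def f_inv_into_f)
  ultimately have "subst Const r P = 0"
    using ind by (simp add: alg_independent_def)
  \<comment> \<open>Renaming back by \<open>Var (f i)\<close> undoes \<open>r\<close> on the image
    of \<open>I\<close> and so recovers \<open>P\<close>.\<close>
  then have "0 = subst Const (\<lambda>i. Var (f i)) (subst Const r P)"
    by simp
  also have "\<dots> = subst Const Var P"
    using eq[of "\<lambda>g. Var (f (inv_into I f g))" Var]
    by (simp add: cf.subst.hom_subst r_def f_inv_into_f)
  finally show "P = 0" by simp
qed

section \<open>Uniqueness of digits in base \<open>B\<close>\<close>

lemma digits_unique:
  fixes a b :: "nat \<Rightarrow> nat"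
  assumes "\<And>k. k < N \<Longrightarrow> a k < B" "\<And>k. k < N \<Longrightarrow> b k < B"
    and "(\<Sum>k<N. a k * B ^ k) = (\<Sum>k<N. b k * B ^ k)" and "k < N"
  shows "a k = b k"
  using assms
proof (induction N arbitrary: a b k)
  case (Suc N)
  have split: "(\<Sum>k<Suc N. c k * B ^ k) = c 0 + B * (\<Sum>k<N. c (Suc k) * B ^ k)" for c :: "nat \<Rightarrow> nat"
    by (simp add: sum.lessThan_Suc_shift sum_distrib_left mult_ac del: sum.lessThan_Suc)
  have eq: "a 0 + B * (\<Sum>k<N. a (Suc k) * B ^ k) = b 0 + B * (\<Sum>k<N. b (Suc k) * B ^ k)"
    using Suc.prems(3) by (simp only: split)
  have lt: "a 0 < B" "b 0 < B"
    using Suc.prems(1,2) by auto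
  \<comment> \<open>The lowest digit is the remainder modulo \<open>B\<close>; cancelling it and
    dividing by \<open>B\<close> leaves the sums of the shifted digits.\<close>
  have "a 0 = b 0"
    using arg_cong[OF eq, of "\<lambda>x. x mod B"] lt by simp
  moreover have "a (Suc l) = b (Suc l)" if "l < N" for l
    by (rule Suc.IH[of "\<lambda>k. a (Suc k)" "\<lambda>k. b (Suc k)"])
       (use Suc.prems(1,2) eq lt \<open>a 0 = b 0\<close> that in auto)
  ultimately show ?case
    using Suc.prems(4) by (cases k) auto
qed simp

lemma indexed_digits_unique:
  fixes a b :: "'i \<Rightarrow> nat"
  assumes I: "finite I" "inj_on pos I"
    and lt: "\<And>i. i \<in> I \<Longrightarrow> a i < B" "\<And>i. i \<in> I \<Longrightarrow> b i < B"
    and eq: "(\<Sum>i\<in>I. a i * B ^ pos i) = (\<Sum>i\<in>I. b i * B ^ pos i)" and i: "i \<in> I"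
  shows "a i = b i"
proof -
  define d where "d = (\<lambda>(c :: 'i \<Rightarrow> nat) k. if k \<in> pos ` I then c (inv_into I pos k) else 0)"
  obtain N where N: "pos ` I \<subseteq> {..<N}"
    using finite_nat_bounded I(1) by (metis finite_imageI)
  have d: "d c (pos j) = c j" if "j \<in> I" for c j
    using that I(2) by (simp add: d_def)
  have "(\<Sum>i\<in>I. c i * B ^ pos i) = (\<Sum>k<N. d c k * B ^ k)" for c
  proof -
    have "(\<Sum>i\<in>I. c i * B ^ pos i) = (\<Sum>k\<in>pos ` I. d c k * B ^ k)"
      using I(2) by (simp add: sum.reindex d)
    also have "\<dots> = (\<Sum>k<N. d c k * B ^ k)"
      using N by (intro sum.mono_neutral_left) (auto simp: d_def)
    finally show ?thesis .
  qed
  moreover have "B > 0" using lt(1)[OF i] by simp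
  then have "d a k < B" "d b k < B" for k
    using lt by (auto simp: d_def inv_into_into)
  ultimately have "d a (pos i) = d b (pos i)"
    using N i eq by (intro digits_unique[of N "d a" B "d b" "pos i"]) auto
  then show ?thesis using i by (simp add: d)
qed

lemma coeff_hom_pCons: "coeff_hom (\<lambda>c. [:c:])"
proof unfold_locales
  show "[:1::complex:] = 1" by (simp only: one_pCons)
  show "[:a + b::complex:] = [:a:] + [:b:]" for a b by simp
  show "[:a * b::complex:] = [:a:] * [:b:]" for a b by simp
qed

text \<open>Along the curve, the order of a monomial in the \<open>f i\<close> has the exponents as
  its base-\<open>B\<close> digits. Once \<open>B\<close> exceeds all exponents in a relation,
  different monomials have different orders, and the term of lowest order cannot cancel.\<close>

lemma alg_independent_by_order:
  fixes f :: "'i \<Rightarrow> 'j cpoly" and pos :: "'i \<Rightarrow> nat"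
  assumes I: "finite I" "inj_on pos I"
    and curve: "\<And>B. B \<ge> N \<Longrightarrow> \<exists>w. \<forall>i\<in>I. \<exists>g.
      subst (\<lambda>c. [:c:]) (\<lambda>j. monom 1 (w j)) (f i) = monom 1 (B ^ pos i) * g \<and> poly g 0 \<noteq> 0"
  shows "alg_independent I f"
  unfolding alg_independent_def
proof (intro ballI impI, rule ccontr)
  interpret coeff_hom "\<lambda>c::complex. [:c:]" by (rule coeff_hom_pCons)
  fix P assume P: "P \<in> polys_in I" "subst Const f P = 0" "P \<noteq> 0"
  let ?e = Poly_Mapping.lookup
  \<comment> \<open>The sum of all exponents in \<open>P\<close> bounds each of them; the summands
    \<open>N\<close> and 1 give \<open>B \<ge> N\<close> and a strict bound.\<close>
  define B where "B = N + 1 + (\<Sum>m\<in>Poly_Mapping.keys P. \<Sum>i\<in>Poly_Mapping.keys m. ?e m i)"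
  have less_B: "?e m i < B" if "m \<in> Poly_Mapping.keys P" for m i
  proof (cases "i \<in> Poly_Mapping.keys m")
    case True
    have "?e m i \<le> (\<Sum>i\<in>Poly_Mapping.keys m. ?e m i)"
      using True by (intro member_le_sum) auto
    also have "\<dots> \<le> (\<Sum>m\<in>Poly_Mapping.keys P. \<Sum>i\<in>Poly_Mapping.keys m. ?e m i)"
      using that by (intro member_le_sum) auto
    finally show ?thesis by (simp add: B_def)
  qed (simp add: in_keys_iff B_def)
  have "B \<ge> N" by (simp add: B_def)
  then obtain w where "\<forall>i\<in>I. \<exists>g.
      subst (\<lambda>c. [:c:]) (\<lambda>j. monom 1 (w j)) (f i) = monom 1 (B ^ pos i) * g \<and> poly g 0 \<noteq> 0"
    using curve by blast
  then obtain g where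
    g: "\<And>i. i \<in> I \<Longrightarrow> subst (\<lambda>c. [:c:]) (\<lambda>j. monom 1 (w j)) (f i) = monom 1 (B ^ pos i) * g i"
    and g0: "\<And>i. i \<in> I \<Longrightarrow> poly (g i) 0 \<noteq> 0"
    by metis
  \<comment> \<open>The monomial \<open>m\<close> takes the value \<open>monom 1 (D m) * G m\<close>
    on the curve. As \<open>G m\<close> does not vanish at 0, \<open>D m\<close> is its
    order.\<close>
  define D where "D m = (\<Sum>i\<in>I. ?e m i * B ^ pos i)" for m
  define G where "G m = (\<Prod>i\<in>I. g i ^ ?e m i)" for m
  have inj_D: "m = m'" if "m \<in> Poly_Mapping.keys P" "m' \<in> Poly_Mapping.keys P" "D m = D m'" for m m'
  proof (rule poly_mapping_eqI)
    fix i show "?e m i = ?e m' i"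
    proof (cases "i \<in> I")
      case True
      show ?thesis
        by (rule indexed_digits_unique[OF I, where B = B])
           (use that True in \<open>simp_all add: D_def less_B\<close>)
    next
      case False
      then have "i \<notin> Poly_Mapping.keys m" "i \<notin> Poly_Mapping.keys m'"
        using P(1) that by (auto simp: polys_in_def)
      then show ?thesis by (simp add: in_keys_iff)
    qed
  qed
  have *: "monomial_value (\<lambda>i. subst (\<lambda>c. [:c:]) (\<lambda>j. monom 1 (w j)) (f i)) m = monom 1 (D m) * G m"
    if "m \<in> Poly_Mapping.keys P" for m
  proof -
    have "monomial_value (\<lambda>i. subst (\<lambda>c. [:c:]) (\<lambda>j. monom 1 (w j)) (f i)) m
        = (\<Prod>i\<in>I. (monom 1 (B ^ pos i) * g i) ^ ?e m i)"
      using P(1) that I(1) by (subst monomial_value_superset[of I]) (auto simp: polys_in_def g)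
    also have "\<dots> = (\<Prod>i\<in>I. monom 1 (?e m i * B ^ pos i)) * G m"
      by (simp add: power_mult_distrib prod.distrib G_def monom_power mult.commute)
    also have "(\<Prod>i\<in>I. monom 1 (?e m i * B ^ pos i)) = (monom 1 (D m) :: complex poly)"
      unfolding D_def using I(1)
      by (induction I rule: finite_induct) (simp_all add: mult_monom)
    finally show ?thesis .
  qed
  have "0 = subst (\<lambda>c. [:c:]) (\<lambda>j. monom 1 (w j)) (subst Const f P)"
    using P(2) by simp
  also have "\<dots> = (\<Sum>m\<in>Poly_Mapping.keys P. [:?e P m:] * (monom 1 (D m) * G m))"
    by (subst subst.hom_subst, subst subst_monomial_value[of _ _ P]) (simp add: *)
  finally have sum0: "(\<Sum>m\<in>Poly_Mapping.keys P. [:?e P m:] * (monom 1 (D m) * G m)) = 0"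
    by (rule sym)
  have "Poly_Mapping.keys P \<noteq> {}" using P(3) by simp
  then obtain m0 where m0: "m0 \<in> Poly_Mapping.keys P" "\<And>m. m \<in> Poly_Mapping.keys P \<Longrightarrow> D m0 \<le> D m"
    using arg_min_if_finite(1)[of "Poly_Mapping.keys P" D] arg_min_least[of "Poly_Mapping.keys P" _ D]
    by (metis finite_keys)
  \<comment> \<open>In degree \<open>D m0\<close> only \<open>m0\<close> contributes, since
    \<open>D\<close> is injective on the monomials of \<open>P\<close> and minimal at
    \<open>m0\<close>.\<close>
  have "0 = (\<Sum>m\<in>Poly_Mapping.keys P. coeff ([:?e P m:] * (monom 1 (D m) * G m)) (D m0))"
    using arg_cong[OF sum0, of "\<lambda>p. coeff p (D m0)"] by (simp add: coeff_sum)
  also have "\<dots> = (\<Sum>m\<in>Poly_Mapping.keys P. if m = m0 then ?e P m0 * coeff (G m0) 0 else 0)"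
  proof (intro sum.cong refl)
    fix m assume m: "m \<in> Poly_Mapping.keys P"
    have "m = m0 \<or> D m0 < D m"
      using m0 m inj_D by (metis le_neq_implies_less)
    then show "coeff ([:?e P m:] * (monom 1 (D m) * G m)) (D m0) =
        (if m = m0 then ?e P m0 * coeff (G m0) 0 else 0)"
      by (auto simp: coeff_monom_mult)
  qed
  also have "\<dots> = ?e P m0 * coeff (G m0) 0"
    using m0(1) by simp
  finally have "coeff (G m0) 0 = 0"
    using m0(1) by (simp add: in_keys_iff)
  moreover have "coeff (G m0) 0 \<noteq> 0"
    using I(1) g0 by (simp add: G_def poly_prod flip: poly_0_coeff_0)
  ultimately show False by simp
qed

subsection \<open>Units and their marks\<close>

lemma cyc_in: "n > 0 \<Longrightarrow> cyc n j \<in> {1..2 * int n}"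
  by (auto simp: cyc_def) (smt (verit) pos_mod_bound of_nat_0_less_iff)

lemma cyc_eq_iff: "cyc n i = cyc n j \<longleftrightarrow> 2 * int n dvd i - j"
  by (simp add: cyc_def mod_eq_dvd_iff)

lemma cyc_cyc_add [simp]: "cyc n (cyc n i + j) = cyc n (i + j)"
  by (simp add: cyc_def mod_simps algebra_simps)

lemma cyc_cyc_diff [simp]: "cyc n (cyc n i - j) = cyc n (i - j)"
  using cyc_cyc_add[of n i "- j"] by simp

lemma cyc_cyc [simp]: "cyc n (cyc n i) = cyc n i"
  using cyc_cyc_add[of n i 0] by simp

lemma cyc_neq:
  assumes "i \<noteq> j" "\<bar>i - j\<bar> < 2 * int n" shows "cyc n i \<noteq> cyc n j"
  using assms zdvd_imp_le[of "2 * int n" "i - j"] zdvd_imp_le[of "2 * int n" "j - i"]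
  by (auto simp: cyc_eq_iff dvd_diff_commute abs_if split: if_splits)

text \<open>The direction \<open>e\<close> says on which side of its mark the other two elements of a triple lie.\<close>

locale pentagram =
  fixes n :: nat and p :: "int \<Rightarrow> bool" and e :: int
  assumes n: "n \<ge> 3" and p: "p = odd \<or> p = even" and e: "e = 1 \<or> e = - 1"
begin

abbreviation c :: "int \<Rightarrow> int" where "c \<equiv> cyc n"

abbreviation idx :: "int set" where "idx \<equiv> {j \<in> {1..2 * int n}. p j}"

lemma c_in: "c j \<in> {1..2 * int n}"
  using n by (intro cyc_in) simp

lemma p_c [simp]: "p (c j) \<longleftrightarrow> p j"
  using p by (auto simp: even_cyc)

lemma p_shift [simp]:
  "p (j + 2 * i) \<longleftrightarrow> p j" "p (j - 2 * i) \<longleftrightarrow> p j" "p (j - 4 * i) \<longleftrightarrow> p j" "p (j + 4 * i) \<longleftrightarrow> p j"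
  "p (j + e) \<longleftrightarrow> \<not> p j" "p (j - e) \<longleftrightarrow> \<not> p j"
  using p e by auto

text \<open>Since \<open>n \<ge> 3\<close>, a shift by less than 6 is less than a full turn. The
  arguments below compare shifts by 2 and by 4.\<close>

lemma c_neq [simp]:
  assumes "0 < \<bar>i\<bar>" "\<bar>i\<bar> < 6"
  shows "c (j + i) \<noteq> c j" "c j \<noteq> c (j + i)"
  using assms n cyc_neq[of "j + i" j n] by auto

lemma idx_c: "j \<in> idx \<Longrightarrow> c j = j"
  by (simp add: cyc_id)

lemma c_swap:
  assumes "i \<in> {1..2 * int n}" "j \<in> {1..2 * int n}"
  shows "c (i + l) = j \<longleftrightarrow> i = c (j - l)"
  using assms by (metis add_diff_cancel_right' cyc_cyc_add cyc_cyc_diff cyc_id diff_add_cancel)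

section \<open>Units described by their marks\<close>

definition unit_at :: "bool \<Rightarrow> int \<Rightarrow> int set" where
  "unit_at s j = (if s then {j, c (j - e), c (j - 2 * e)} else {j})"

lemma units_eq: "units n p = {unit_at s j |s j. j \<in> idx}"
proof (intro set_eqI iffI)
  fix U assume "U \<in> units n p"
  then consider j where "j \<in> idx" "U = {j}"
    | k where "k \<in> {1..2 * int n}" "\<not> p k" "U = {c (k - 1), k, c (k + 1)}"
    by (auto simp: units_def)
  then show "U \<in> {unit_at s j |s j. j \<in> idx}"
  proof cases
    case 1
    then have "U = unit_at False j" by (simp add: unit_at_def)
    with 1 show ?thesis by blast
  next
    case 2
    \<comment> \<open>The mark of the triple centred at \<open>k\<close> is its end in direction
      \<open>e\<close>.\<close>
    have "c (k + e) \<in> idx" using 2 c_in[of "k + e"] by simp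
    moreover have "U = unit_at True (c (k + e))"
      using 2 e by (auto simp: unit_at_def cyc_id)
    ultimately show ?thesis by blast
  qed
next
  fix U assume "U \<in> {unit_at s j |s j. j \<in> idx}"
  then obtain s j where j: "j \<in> idx" "U = unit_at s j" by blast
  show "U \<in> units n p"
  proof (cases s)
    case False
    then show ?thesis using j by (auto simp: units_def unit_at_def)
  next
    case True
    have "c (j - e) \<in> {1..2 * int n}" "\<not> p (c (j - e))" using c_in[of "j - e"] j by simp_all
    moreover have "c (2 + j) = c (j + 2)" by (simp only: add.commute)
    then have "U = {c (c (j - e) - 1), c (j - e), c (c (j - e) + 1)}"
      using j True e idx_c[OF j(1)] by (auto simp: unit_at_def)
    ultimately show ?thesis unfolding units_def by blast
  qed
qed

section \<open>Cyclic runs and consecutive units\<close>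

lemma cyclic_run_directed:
  "cyclic_run n p T \<longleftrightarrow> (\<exists>a m. p a \<and> T = (\<lambda>i. c (a + 2 * e * int i)) ` {..<m})"
proof -
  \<comment> \<open>Reading an interval from its last element reverses the direction, by the
    reindexing of \<open>i\<close> to \<open>m - 1 - i\<close>.\<close>
  have rev: "(\<lambda>i. c (a + 2 * d * int i)) ` {..<m} =
      (\<lambda>i. c (a + 2 * d * (int m - 1) + 2 * (- d) * int i)) ` {..<m}" for a m d
  proof -
    have "{..<m} = (\<lambda>i. m - 1 - i) ` {..<m}"
    proof (intro set_eqI iffI)
      fix i assume "i \<in> {..<m}"
      then show "i \<in> (\<lambda>i. m - 1 - i) ` {..<m}"
        by (intro image_eqI[of _ _ "m - 1 - i"]) auto
    qed auto
    from arg_cong[OF this, of "image (\<lambda>i. c (a + 2 * d * int i))"]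
    have "(\<lambda>i. c (a + 2 * d * int i)) ` {..<m} =
        (\<lambda>i. c (a + 2 * d * int (m - 1 - i))) ` {..<m}"
      by (simp add: image_image)
    also have "\<dots> = (\<lambda>i. c (a + 2 * d * (int m - 1) + 2 * (- d) * int i)) ` {..<m}"
      by (intro image_cong refl arg_cong[of _ _ c]) (simp add: of_nat_diff algebra_simps)
    finally show ?thesis .
  qed
  have p2: "p (a + 2 * d * l) \<longleftrightarrow> p a" for a d l :: int
    using p by auto
  have turn: "\<exists>b m'. p b \<and> (\<lambda>i. c (a + 2 * d * int i)) ` {..<m} = (\<lambda>i. c (b + 2 * (- d) * int i)) ` {..<m'}"
    if "p a" for a d m
    using rev p2 that by blast
  show ?thesis
    using e turn[of _ 1] turn[of _ "- 1"] unfolding cyclic_run_def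
    by (elim disjE) (simp, simp, blast)
qed

text \<open>Only the last element in direction \<open>e\<close> can have its successor outside the
  run. Two different such elements therefore show that a set is not a run, which is how units are
  proved not to be consecutive.\<close>

lemma cyclic_run_end_unique:
  assumes "cyclic_run n p T" "i \<in> T" "j \<in> T" "c (i + 2 * e) \<notin> T" "c (j + 2 * e) \<notin> T"
  shows "i = j"
proof -
  obtain a m where T: "T = (\<lambda>i. c (a + 2 * e * int i)) ` {..<m}"
    using assms(1) cyclic_run_directed by auto
  have "z = c (a + 2 * e * (int m - 1))" if z: "z \<in> T" "c (z + 2 * e) \<notin> T" for z
  proof -
    obtain l where l: "l < m" "z = c (a + 2 * e * int l)"
      using z(1) unfolding T by blast
    have "Suc l = m"
    proof (rule ccontr)
      assume "Suc l \<noteq> m"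
      then have "c (a + 2 * e * int (Suc l)) \<in> T"
        using l unfolding T by (intro image_eqI[of _ _ "Suc l"]) auto
      then show False
        using z(2) l(2) by (simp add: distrib_left add.assoc add.commute[of "2 * e"])
    qed
    then show ?thesis using l by auto
  qed
  then show ?thesis using assms by metis
qed

lemma p_part: "j \<in> idx \<Longrightarrow> {i \<in> unit_at s j. p i} = (if s then {j, c (j - 2 * e)} else {j})"
  by (auto simp: unit_at_def)

lemma run_imageI: "p a \<Longrightarrow> T = (\<lambda>i. c (a + 2 * e * int i)) ` {..<m} \<Longrightarrow> cyclic_run n p T"
  using cyclic_run_directed by blast

lemma upto_simps: "{..<2::nat} = {0,1}" "{..<3::nat} = {0,1,2}" "{..<4::nat} = {0,1,2,3}"
  by auto

text \<open>Hence no decomposition contains both the singleton and the triple with the same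
  mark.\<close>

lemma consecutive_same: 
  assumes "j \<in> idx" shows "consecutive n p (unit_at s j) (unit_at t j)"
proof -
  have "{i \<in> unit_at s j \<union> unit_at t j. p i} = {i \<in> unit_at (s \<or> t) j. p i}"
    by (auto simp: unit_at_def)
  moreover have "cyclic_run n p {i \<in> unit_at True j. p i}"
    using assms by (intro run_imageI[of "j - 2 * e" _ 2])
      (auto simp: p_part upto_simps idx_c)
  moreover have "cyclic_run n p {i \<in> unit_at False j. p i}"
    using assms by (intro run_imageI[of j _ 1]) (auto simp: p_part idx_c lessThan_Suc)
  ultimately show ?thesis
    unfolding consecutive_def by (cases "s \<or> t") auto
qed

lemma consecutive_near:
  assumes "i \<in> idx" "j \<in> idx" "j = c (i + 2 * e) \<or> t \<and> j = c (i + 4 * e)"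
  shows "consecutive n p (unit_at s i) (unit_at t j)"
proof -
  have "{l \<in> unit_at s i \<union> unit_at t j. p l} = {l \<in> unit_at s i. p l} \<union> {l \<in> unit_at t j. p l}"
    by auto
  also have "\<dots> = (if s then {i, c (i - 2 * e)} else {i}) \<union> (if t then {j, c (j - 2 * e)} else {j})"
    using assms by (simp add: p_part)
  finally have eq: "{l \<in> unit_at s i \<union> unit_at t j. p l} = \<dots>" .
  have ci: "c i = i" using assms idx_c by blast
  have pi: "p i" "p (i - 2 * e)" using assms(1) by simp_all
  consider "j = c (i + 2 * e)" | "t" "j = c (i + 4 * e)" using assms(3) by blast
  \<comment> \<open>In direction \<open>e\<close> the run starts at \<open>i - 2 * e\<close> if
    \<open>s\<close> holds and at \<open>i\<close> otherwise, and it ends at \<open>j\<close>; this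
    gives the lengths 2 to 4.\<close>
  then show ?thesis
  proof cases
    case 1
    then have j: "c (j - 2 * e) = i" by (simp add: ci)
    show ?thesis
    proof (cases s)
      case True
      show ?thesis unfolding consecutive_def eq
        using assms(1) True 1 j ci
        by (intro run_imageI[OF pi(2), of _ 3]) (auto simp: upto_simps algebra_simps)
    next
      case False
      show ?thesis unfolding consecutive_def eq
        using assms(1) False 1 j ci
        by (intro run_imageI[OF pi(1), of _ 2]) (auto simp: upto_simps algebra_simps)
    qed
  next
    case 2
    then have j: "c (j - 2 * e) = c (i + 2 * e)" by (simp add: algebra_simps)
    show ?thesis
    proof (cases s)
      case True
      show ?thesis unfolding consecutive_def eq j
        using assms(1) True 2 ci
        by (intro run_imageI[OF pi(2), of _ 4]) (auto simp: upto_simps algebra_simps)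
    next
      case False
      show ?thesis unfolding consecutive_def eq j
        using assms(1) False 2 ci
        by (intro run_imageI[OF pi(1), of _ 3]) (auto simp: upto_simps algebra_simps)
    qed
  qed
qed

lemma consecutive_commute: "consecutive n p U V \<longleftrightarrow> consecutive n p V U"
  by (simp add: consecutive_def Un_commute)

text \<open>If none of the four conditions holds, both marks have their successor outside the union,
  contrary to \<open>cyclic_run_end_unique\<close>. Distance 4 enters because the far end of a
  triple lies two steps before its mark.\<close>

lemma consecutive_iff:
  assumes ij: "i \<in> idx" "j \<in> idx" "i \<noteq> j"
  shows "consecutive n p (unit_at s i) (unit_at t j) \<longleftrightarrow>
    j = c (i + 2 * e) \<or> i = c (j + 2 * e) \<or> t \<and> j = c (i + 4 * e) \<or> s \<and> i = c (j + 4 * e)"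
    (is "_ \<longleftrightarrow> ?near")
proof
  assume cons: "consecutive n p (unit_at s i) (unit_at t j)"
  show ?near
  proof (rule ccontr)
    assume far: "\<not> ?near"
    let ?W = "{l \<in> unit_at s i \<union> unit_at t j. p l}"
    have W: "?W = (if s then {i, c (i - 2 * e)} else {i}) \<union> (if t then {j, c (j - 2 * e)} else {j})"
      using p_part[OF ij(1), of s] p_part[OF ij(2), of t] by blast
    have ne: "c (l + 2 * e) \<noteq> l" "c (l + 2 * e) \<noteq> c (l - 2 * e)" if "l \<in> idx" for l
    proof -
      show "c (l + 2 * e) \<noteq> l"
        using c_neq(1)[of "2 * e" l] idx_c[OF that] e by auto
      have eq: "l - 2 * e + 4 * e = l + 2 * e" by simp
      have "c (l - 2 * e + 4 * e) \<noteq> c (l - 2 * e)"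
        by (rule c_neq) (use e in auto)
      from this[unfolded eq] show "c (l + 2 * e) \<noteq> c (l - 2 * e)" .
    qed
    have far2: "c (l + 2 * e) = c (l' - 2 * e) \<Longrightarrow> l' = c (l + 4 * e)" if "l' \<in> idx" for l l'
      using idx_c[OF that] cyc_cyc_add[of n "l + 2 * e" "2 * e"] cyc_cyc_add[of n "l' - 2 * e" "2 * e"]
      by (simp add: algebra_simps)
    have "c (i + 2 * e) \<notin> ?W"
      using far ne[OF ij(1)] far2[OF ij(2), of i] unfolding W by auto
    moreover have "c (j + 2 * e) \<notin> ?W"
      using far ne[OF ij(2)] far2[OF ij(1), of j] unfolding W by auto
    moreover have "i \<in> ?W" "j \<in> ?W" unfolding W by auto
    ultimately show False
      using cyclic_run_end_unique[of ?W i j] cons ij(3) unfolding consecutive_def by blast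
  qed
next
  assume ?near
  then show "consecutive n p (unit_at s i) (unit_at t j)"
    using consecutive_near[OF ij(1,2)] consecutive_near[OF ij(2,1)] consecutive_commute by blast
qed

section \<open>Admissible sets as sets of marks with chosen triples\<close>

definition marks :: "nat \<Rightarrow> int set set" where
  "marks k = {M. M \<subseteq> idx \<and> card M = k \<and> (\<forall>j\<in>M. c (j + 2 * e) \<notin> M)}"

text \<open>By \<open>consecutive_iff\<close> these are the marks that may carry a triple.\<close>

definition free :: "int set \<Rightarrow> int set" where
  "free M = {j \<in> M. c (j - 4 * e) \<notin> M}"

definition support :: "int set \<Rightarrow> int set \<Rightarrow> int set" where
  "support M T = (\<Union>j\<in>M. unit_at (j \<in> T) j)"

text \<open>The formula from the overview, over any commutative ring, so that it can be evaluated at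
  the variables, at points over a field and along curves.\<close>

definition mark_sum :: "nat \<Rightarrow> (int \<Rightarrow> 'b::comm_ring_1) \<Rightarrow> 'b" where
  "mark_sum k x = (- 1) ^ k *
     (\<Sum>M\<in>marks k. (\<Prod>j\<in>M. x j) * (\<Prod>j\<in>free M. 1 - x (c (j - e)) * x (c (j - 2 * e))))"

lemma finite_idx: "finite idx"
  by (rule finite_subset[of _ "{1..2 * int n}"]) auto

lemma finite_marks: "finite (marks k)"
proof (rule finite_subset)
  show "marks k \<subseteq> Pow idx" by (auto simp: marks_def)
  show "finite (Pow idx)" by (simp only: finite_Pow_iff finite_idx)
qed

lemma marks_finite: "M \<in> marks k \<Longrightarrow> finite M"
  by (rule finite_subset[OF _ finite_idx]) (simp add: marks_def)

lemma marks_idx: "M \<in> marks k \<Longrightarrow> j \<in> M \<Longrightarrow> j \<in> idx"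
  by (auto simp: marks_def)

lemma finite_free: "M \<in> marks k \<Longrightarrow> finite (free M)"
  using marks_finite by (simp add: free_def)

lemma free_subset: "free M \<subseteq> M"
  by (auto simp: free_def)

lemma c_inject: "i \<in> {1..2 * int n} \<Longrightarrow> j \<in> {1..2 * int n} \<Longrightarrow> c (i + l) = c (j + l) \<Longrightarrow> i = j"
  by (metis c_swap add_diff_cancel_right' c_in cyc_cyc_diff cyc_id)

lemma c_inject_diff: "i \<in> {1..2 * int n} \<Longrightarrow> j \<in> {1..2 * int n} \<Longrightarrow> c (i - l) = c (j - l) \<Longrightarrow> i = j"
  by (rule c_inject[of i j "- l", unfolded add_uminus_conv_diff])

text \<open>The middle of a triple is its only element of the other parity, and it identifies the
  triple.\<close>

lemma unit_at_not_p: "j \<in> idx \<Longrightarrow> \<not> p i \<Longrightarrow> i \<in> unit_at s j \<longleftrightarrow> s \<and> i = c (j - e)"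
  by (auto simp: unit_at_def)

lemma unit_at_inject:
  assumes "i \<in> idx" "j \<in> idx" "unit_at s i = unit_at t j"
  shows "i = j" "s = t"
proof -
  have "\<not> p (c (i - e))" "\<not> p (c (j - e))" using assms(1,2) by simp_all
  with assms have *: "s \<longleftrightarrow> t \<and> c (i - e) = c (j - e)" "t \<longleftrightarrow> s \<and> c (j - e) = c (i - e)"
    using unit_at_not_p by metis+
  then show "s = t" by blast
  show "i = j"
  proof (cases s)
    case True
    then have "c (i - e) = c (j - e)" using * by blast
    then show ?thesis using assms(1,2) c_inject_diff by blast
  next
    case False
    then have "\<not> s" "\<not> t" using * by blast+
    then show ?thesis using assms(3) by (simp add: unit_at_def)
  qed
qed

lemma inj_unit_at: "M \<subseteq> idx \<Longrightarrow> inj_on (\<lambda>j. unit_at (j \<in> T) j) M"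
proof (rule inj_onI)
  fix i j
  assume "M \<subseteq> idx" "i \<in> M" "j \<in> M" and eq: "unit_at (i \<in> T) i = unit_at (j \<in> T) j"
  then have "i \<in> idx" "j \<in> idx" by blast+
  then show "i = j" using eq by (rule unit_at_inject(1))
qed

lemma unit_decomposition_marks:
  assumes M: "M \<in> marks k" and k: "k > 0" and T: "T \<subseteq> free M"
  shows "unit_decomposition n p ((\<lambda>j. unit_at (j \<in> T) j) ` M) (support M T)"
  unfolding unit_decomposition_def
proof (intro conjI ballI impI)
  show "(\<lambda>j. unit_at (j \<in> T) j) ` M \<noteq> {}" using M k by (auto simp: marks_def)
  show "(\<lambda>j. unit_at (j \<in> T) j) ` M \<subseteq> units n p"
    using marks_idx[OF M] unfolding units_eq by blast
  show "support M T = \<Union> ((\<lambda>j. unit_at (j \<in> T) j) ` M)" by (simp add: support_def)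
  fix U V assume "U \<in> (\<lambda>j. unit_at (j \<in> T) j) ` M" "V \<in> (\<lambda>j. unit_at (j \<in> T) j) ` M" "U \<noteq> V"
  then obtain i j where ij: "i \<in> M" "j \<in> M" "i \<noteq> j" "U = unit_at (i \<in> T) i" "V = unit_at (j \<in> T) j"
    by blast
  \<comment> \<open>Applied in both orders of the pair, this negates the four conditions of
    \<open>consecutive_iff\<close>.\<close>
  have far: "l' \<noteq> c (l + 2 * e)" "\<not> (l' \<in> T \<and> l' = c (l + 4 * e))" if "l \<in> M" "l' \<in> M" for l l'
  proof -
    show "l' \<noteq> c (l + 2 * e)" using M that by (auto simp: marks_def)
    have "c (c (l + 4 * e) - 4 * e) = l" using idx_c[OF marks_idx[OF M that(1)]] by simp
    then show "\<not> (l' \<in> T \<and> l' = c (l + 4 * e))" using T that by (auto simp: free_def)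
  qed
  show "\<not> consecutive n p U V"
    using consecutive_iff[OF marks_idx[OF M ij(1)] marks_idx[OF M ij(2)] ij(3)]
      far[OF ij(1,2)] far[OF ij(2,1)] ij(4,5) by blast
qed

text \<open>Converse to \<open>unit_decomposition_marks\<close>: the marks are read off the units,
  and \<open>T\<close> consists of those whose unit is a triple.\<close>

lemma unit_decomposition_obtain_marks:
  assumes F: "unit_decomposition n p F S"
  obtains M T where "M \<in> marks (card F)" "T \<subseteq> free M" "S = support M T" "card F > 0"
proof -
  define M where "M = {j \<in> idx. unit_at True j \<in> F \<or> unit_at False j \<in> F}"
  define T where "T = {j \<in> idx. unit_at True j \<in> F}"
  have M_idx: "M \<subseteq> idx" and TM: "T \<subseteq> M" by (auto simp: M_def T_def)
  have cons: "U = V" if "U \<in> F" "V \<in> F" "consecutive n p U V" for U V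
    using F that by (auto simp: unit_decomposition_def)
  \<comment> \<open>Each mark carries one unit only, by \<open>consecutive_same\<close>.\<close>
  have in_F: "unit_at s j \<in> F \<longleftrightarrow> j \<in> M \<and> s = (j \<in> T)" if "j \<in> idx" for s j
  proof -
    have "\<not> (unit_at True j \<in> F \<and> unit_at False j \<in> F)"
      using cons[OF _ _ consecutive_same[OF that]] unit_at_inject(2)[OF that that] by blast
    then show ?thesis using that by (cases s) (auto simp: M_def T_def)
  qed
  have F_eq: "F = (\<lambda>j. unit_at (j \<in> T) j) ` M"
  proof
    show "F \<subseteq> (\<lambda>j. unit_at (j \<in> T) j) ` M"
    proof
      fix U assume "U \<in> F"
      moreover from this have "U \<in> units n p" using F by (auto simp: unit_decomposition_def)
      ultimately obtain s j where "j \<in> idx" "U = unit_at s j" "unit_at s j \<in> F"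
        unfolding units_eq by blast
      then show "U \<in> (\<lambda>j. unit_at (j \<in> T) j) ` M" using in_F[of j s] by auto
    qed
    show "(\<lambda>j. unit_at (j \<in> T) j) ` M \<subseteq> F" using in_F M_idx by auto
  qed
  have fin: "finite M" using M_idx by (rule finite_subset) (rule finite_idx)
  have far: "j \<noteq> c (i + 2 * e)" "\<not> (j \<in> T \<and> j = c (i + 4 * e))" if "i \<in> M" "j \<in> M" "i \<noteq> j" for i j
  proof -
    have "i \<in> idx" "j \<in> idx" using that M_idx by auto
    moreover have "\<not> consecutive n p (unit_at (i \<in> T) i) (unit_at (j \<in> T) j)"
    proof
      assume "consecutive n p (unit_at (i \<in> T) i) (unit_at (j \<in> T) j)"
      moreover have "unit_at (i \<in> T) i \<in> F" "unit_at (j \<in> T) j \<in> F"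
        using that in_F \<open>i \<in> idx\<close> \<open>j \<in> idx\<close> by simp_all
      ultimately have "unit_at (i \<in> T) i = unit_at (j \<in> T) j"
        using cons by simp
      then show False
        using unit_at_inject(1)[OF \<open>i \<in> idx\<close> \<open>j \<in> idx\<close>] that(3) by simp
    qed
    ultimately show "j \<noteq> c (i + 2 * e)" "\<not> (j \<in> T \<and> j = c (i + 4 * e))"
      using consecutive_iff[of i j] that(3) by blast+
  qed
  \<comment> \<open>The fact \<open>far\<close> is about two different marks; this shows that shifts
    by 2 and 4 do lead to a different index.\<close>
  have ne: "c (j + l * e) \<noteq> j" if "j \<in> M" "0 < l" "l < 6" for j l
  proof -
    have "c j = j" using that(1) M_idx idx_c by blast
    then show ?thesis using c_neq(1)[of "l * e" j] that(2,3) e by auto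
  qed
  have "card F = card M"
    unfolding F_eq by (rule card_image) (rule inj_unit_at[OF M_idx])
  moreover have "c (j + 2 * e) \<notin> M" if "j \<in> M" for j
    using far(1)[of j "c (j + 2 * e)"] ne[of j 2] that by fastforce
  ultimately have "M \<in> marks (card F)"
    using M_idx by (simp add: marks_def)
  moreover have "T \<subseteq> free M"
  proof
    fix j assume j: "j \<in> T"
    then have "j \<in> M" using TM by blast
    have *: "j = c (c (j - 4 * e) + 4 * e)" using \<open>j \<in> M\<close> M_idx idx_c[of j] by auto
    have "c (j - 4 * e) \<notin> M"
    proof
      assume back4: "c (j - 4 * e) \<in> M"
      have "c (c (j - 4 * e) + 4 * e) \<noteq> c (j - 4 * e)"
        by (rule ne[OF back4]) simp_all
      then have "c (j - 4 * e) \<noteq> j" using * by metis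
      then show False using far(2)[OF back4 \<open>j \<in> M\<close>] * j by blast
    qed
    then show "j \<in> free M" using \<open>j \<in> M\<close> by (simp add: free_def)
  qed
  moreover have "S = support M T"
    using F unfolding support_def unit_decomposition_def F_eq by simp
  moreover have "card F > 0"
    using F fin by (simp add: unit_decomposition_def F_eq card_gt_0_iff)
  ultimately show thesis using that by blast
qed

text \<open>Uniqueness of the decomposition makes weight and sign computable: the singletons are the
  units at \<open>M - T\<close>, and there are \<open>k - card T\<close> of them.\<close>

lemma marks_data:
  assumes M: "M \<in> marks k" and k: "k > 0" and T: "T \<subseteq> free M"
  shows "units_of n p (support M T) = (\<lambda>j. unit_at (j \<in> T) j) ` M"
    and "admissible n p (support M T)" and "weight n p (support M T) = k"
    and "of_int (sign n p (support M T)) = (- 1 :: 'b::comm_ring_1) ^ k * (- 1) ^ card T"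
proof -
  have dec: "unit_decomposition n p ((\<lambda>j. unit_at (j \<in> T) j) ` M) (support M T)"
    using assms by (rule unit_decomposition_marks)
  show units: "units_of n p (support M T) = (\<lambda>j. unit_at (j \<in> T) j) ` M"
    using dec p units_of_eq by blast
  show "admissible n p (support M T)" using dec by (auto simp: admissible_def)
  have M_idx: "M \<subseteq> idx" using M by (simp add: marks_def)
  show "weight n p (support M T) = k"
    using M card_image[OF inj_unit_at[OF M_idx, of T]] by (simp add: weight_def units marks_def)
  have single: "is_singleton (unit_at s j) \<longleftrightarrow> \<not> s" if "j \<in> idx" for s j
  proof (cases s)
    case True
    have "p j" "\<not> p (c (j - e))" using that by simp_all
    then have "c (j - e) \<noteq> j" by metis
    then show ?thesis using True by (auto simp: unit_at_def is_singleton_def doubleton_eq_iff)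
  qed (simp add: unit_at_def)
  have "{U \<in> units_of n p (support M T). is_singleton U} = (\<lambda>j. unit_at (j \<in> T) j) ` (M - T)"
    unfolding units using M_idx single by blast
  moreover have "card ((\<lambda>j. unit_at (j \<in> T) j) ` (M - T)) = card (M - T)"
    by (rule card_image, rule inj_unit_at) (use M_idx in blast)
  moreover have "T \<subseteq> M" using T free_subset by blast
  then have "card (M - T) = k - card T" "card T \<le> k"
    using marks_finite[OF M] M by (auto simp: card_Diff_subset finite_subset marks_def intro: card_mono)
  ultimately show "of_int (sign n p (support M T)) = (- 1 :: 'b) ^ k * (- 1) ^ card T"
    by (auto simp: sign_def minus_one_power_iff)
qed

section \<open>Products over admissible sets and the formula for the invariants\<close>

lemma prod_unit_at:
  fixes f :: "int \<Rightarrow> 'b::comm_monoid_mult"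
  assumes "j \<in> idx"
  shows "prod f (unit_at s j) = f j * (if s then f (c (j - e)) * f (c (j - 2 * e)) else 1)"
proof -
  have "p j" "\<not> p (c (j - e))" "p (c (j - 2 * e))"
    using assms by simp_all
  then have "c (j - e) \<noteq> j" "c (j - e) \<noteq> c (j - 2 * e)"
    by metis+
  moreover have "j \<noteq> c (j - 2 * e)"
    using c_neq(2)[of "- (2 * e)" j] idx_c[OF assms] e by auto
  ultimately show ?thesis by (simp add: unit_at_def)
qed

text \<open>The units are disjoint: a common element of the other parity would be the middle of both
  triples, and one of parity \<open>p\<close> would force the marks to be equal or to differ by
  2.\<close>

lemma prod_support:
  fixes f :: "int \<Rightarrow> 'b::comm_monoid_mult"
  assumes M: "M \<in> marks k" and T: "T \<subseteq> free M"
  shows "prod f (support M T) = prod f M * (\<Prod>j\<in>T. f (c (j - e)) * f (c (j - 2 * e)))"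
proof -
  have disj: "unit_at (i \<in> T) i \<inter> unit_at (j \<in> T) j = {}" if ij: "i \<in> M" "j \<in> M" "i \<noteq> j" for i j
  proof (rule ccontr)
    have ij_idx: "i \<in> idx" "j \<in> idx" using marks_idx[OF M] ij by auto
    have no_left: "l \<noteq> c (l' - 2 * e)" if "l \<in> M" "l' \<in> M" for l l'
    proof
      assume "l = c (l' - 2 * e)"
      then have "c (l + 2 * e) = l'" using idx_c[OF marks_idx[OF M that(2)]] by simp
      then show False using M that by (auto simp: marks_def)
    qed
    assume "unit_at (i \<in> T) i \<inter> unit_at (j \<in> T) j \<noteq> {}"
    then obtain x where x: "x \<in> unit_at (i \<in> T) i" "x \<in> unit_at (j \<in> T) j" by blast
    show False
    proof (cases "p x")
      case False
      then show False
        using x ij_idx unit_at_not_p c_inject_diff[of i j e] ij(3) by auto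
    next
      case True
      then have "x \<in> {i, c (i - 2 * e)}" "x \<in> {j, c (j - 2 * e)}"
        using x p_part[OF ij_idx(1), of "i \<in> T"] p_part[OF ij_idx(2), of "j \<in> T"]
        by (auto split: if_splits)
      then show False
        using no_left[OF ij(1,2)] no_left[OF ij(2,1)] c_inject_diff[of i j "2 * e"] ij_idx ij(3) by auto
    qed
  qed
  have "prod f (support M T) = (\<Prod>j\<in>M. prod f (unit_at (j \<in> T) j))"
    unfolding support_def
    by (rule prod.UNION_disjoint) (use marks_finite[OF M] disj in \<open>auto simp: unit_at_def\<close>)
  also have "\<dots> = (\<Prod>j\<in>M. f j * (if j \<in> T then f (c (j - e)) * f (c (j - 2 * e)) else 1))"
    by (intro prod.cong refl prod_unit_at marks_idx[OF M])
  also have "\<dots> = prod f M * (\<Prod>j\<in>M \<inter> T. f (c (j - e)) * f (c (j - 2 * e)))"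
    by (subst prod.inter_restrict[OF marks_finite[OF M]]) (simp only: prod.distrib)
  also have "M \<inter> T = T" using T free_subset by blast
  finally show ?thesis .
qed

text \<open>The decomposition of a set is unique, and a unit determines both its mark and whether it
  is a triple.\<close>

lemma inj_support:
  assumes k: "k > 0"
  shows "inj_on (\<lambda>(M, T). support M T) (SIGMA M:marks k. Pow (free M))"
proof (rule inj_onI, clarify)
  fix M T M' T'
  assume *: "M \<in> marks k" "M' \<in> marks k" "T \<subseteq> free M" "T' \<subseteq> free M'" "support M T = support M' T'"
  have eq: "(\<lambda>j. unit_at (j \<in> T) j) ` M = (\<lambda>j. unit_at (j \<in> T') j) ` M'"
    using marks_data(1)[OF *(1) k *(3)] marks_data(1)[OF *(2) k *(4)] *(5) by simp
  have sub: "j \<in> M'' \<and> (j \<in> S \<longleftrightarrow> j \<in> S')"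
    if "(\<lambda>j. unit_at (j \<in> S) j) ` L = (\<lambda>j. unit_at (j \<in> S') j) ` M''" "j \<in> L" "L \<subseteq> idx" "M'' \<subseteq> idx"
    for j L S S' M''
  proof -
    have "unit_at (j \<in> S) j \<in> (\<lambda>j. unit_at (j \<in> S') j) ` M''"
      using that(1,2) by blast
    then obtain i where "i \<in> M''" "unit_at (j \<in> S) j = unit_at (i \<in> S') i"
      by blast
    moreover have "j \<in> idx" "i \<in> idx" using that(2-4) \<open>i \<in> M''\<close> by blast+
    ultimately show ?thesis using unit_at_inject[of j i] by metis
  qed
  have idx: "M \<subseteq> idx" "M' \<subseteq> idx" using *(1,2) by (simp_all add: marks_def)
  note sub' = sub[OF eq _ idx] sub[OF eq[symmetric] _ idx(2,1)]
  then have "M = M'" by blast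
  then show "M = M' \<and> T = T'"
    using *(3,4) free_subset[of M] sub' by blast
qed

text \<open>Admissible sets of weight \<open>k\<close> correspond to pairs of a mark set
  \<open>M\<close> and a set \<open>T\<close> of free marks. For fixed \<open>M\<close>, the
  alternating sum over \<open>T\<close> is the expansion of the product over \<open>free M\<close>.
  The left-hand side does not depend on \<open>e\<close>, so the two directions give two formulas
  for one invariant; the exchange of the families relies on this.\<close>

lemma pentagram_inv_marks:
  assumes k: "k > 0" "k \<noteq> n"
  shows "pentagram_inv n p k = mark_sum k Var"
proof -
  let ?A = "SIGMA M:marks k. Pow (free M)"
  let ?g = "\<lambda>j. Var (c (j - e)) * Var (c (j - 2 * e)) :: int cpoly"
  have image: "{S. admissible n p S \<and> weight n p S = k} = (\<lambda>(M, T). support M T) ` ?A"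
  proof (intro set_eqI iffI)
    fix S assume S: "S \<in> {S. admissible n p S \<and> weight n p S = k}"
    then obtain F where F: "unit_decomposition n p F S" by (auto simp: admissible_def)
    then have "card F = k" using S units_of_eq[OF p F] by (simp add: weight_def)
    with F show "S \<in> (\<lambda>(M, T). support M T) ` ?A"
      by (elim unit_decomposition_obtain_marks) auto
  next
    fix S assume "S \<in> (\<lambda>(M, T). support M T) ` ?A"
    then show "S \<in> {S. admissible n p S \<and> weight n p S = k}"
      using marks_data(2,3) k by auto
  qed
  have "pentagram_inv n p k =
      (\<Sum>(M, T)\<in>?A. of_int (sign n p (support M T)) * (\<Prod>j\<in>support M T. Var j))"
    using k sum.reindex[OF inj_support[OF k(1)], of "\<lambda>S. of_int (sign n p S) * (\<Prod>j\<in>S. Var j :: int cpoly)"]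
    by (simp add: pentagram_inv_def image o_def case_prod_unfold)
  also have "\<dots> = (\<Sum>(M, T)\<in>?A. (- 1) ^ k * ((\<Prod>j\<in>M. Var j) * ((- 1) ^ card T * (\<Prod>j\<in>T. ?g j))))"
    using k by (intro sum.cong refl) (auto simp: marks_data(4) prod_support mult_ac)
  also have "\<dots> = (\<Sum>M\<in>marks k. \<Sum>T\<in>Pow (free M).
      (- 1) ^ k * ((\<Prod>j\<in>M. Var j) * ((- 1) ^ card T * (\<Prod>j\<in>T. ?g j))))"
    using finite_marks finite_free by (intro sum.Sigma[symmetric]) auto
  also have "\<dots> = mark_sum k Var"
    using finite_free by (simp add: mark_sum_def prod_diff_conv_sum flip: sum_distrib_left)
  finally show ?thesis .
qed

end

subsection \<open>The substitutions exchange the two families\<close>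

context pentagram
begin

text \<open>The setting of the other family, with triples on the opposite side of their marks. A
  flip connects the two settings.\<close>

lemma dual: "pentagram n (\<lambda>j. \<not> p j) (- e)"
  using n p e by unfold_locales auto

lemma shift_mem:
  assumes "M \<subseteq> idx"
  shows "c z \<in> (\<lambda>j. c (j + l)) ` M \<longleftrightarrow> c (z - l) \<in> M"
proof
  assume "c z \<in> (\<lambda>j. c (j + l)) ` M"
  then obtain j where j: "j \<in> M" "c z = c (j + l)" by blast
  then have "c (z - l) = c j"
    using cyc_cyc_diff[of n z l] cyc_cyc_diff[of n "j + l" l] by simp
  moreover have "c j = j" using j(1) assms idx_c by blast
  ultimately show "c (z - l) \<in> M" using j by simp
next
  assume *: "c (z - l) \<in> M"
  have "c z = c (c (z - l) + l)" by simp
  with * show "c z \<in> (\<lambda>j. c (j + l)) ` M" by blast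
qed

lemma shift_inj: "M \<subseteq> idx \<Longrightarrow> inj_on (\<lambda>j. c (j + l)) M"
proof (rule inj_onI)
  fix i j assume "M \<subseteq> idx" "i \<in> M" "j \<in> M" and eq: "c (i + l) = c (j + l)"
  then have "i \<in> {1..2 * int n}" "j \<in> {1..2 * int n}" by blast+
  then show "i = j" using eq by (rule c_inject)
qed

lemma shift_marks:
  assumes M: "M \<in> marks k"
  shows "(\<lambda>j. c (j + e)) ` M \<in> pentagram.marks n (\<lambda>j. \<not> p j) (- e) k"
proof -
  interpret d: pentagram n "\<lambda>j. \<not> p j" "- e" by (rule dual)
  have M_idx: "M \<subseteq> idx" using M by (simp add: marks_def)
  have "(\<lambda>j. c (j + e)) ` M \<subseteq> {j \<in> {1..2 * int n}. \<not> p j}"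
  proof clarify
    fix j assume "j \<in> M"
    then have "p j" using M_idx by blast
    then show "c (j + e) \<in> {1..2 * int n} \<and> \<not> p (c (j + e))" using c_in by simp
  qed
  moreover have "card ((\<lambda>j. c (j + e)) ` M) = k"
    using M card_image[OF shift_inj[OF M_idx]] by (simp add: marks_def)
  \<comment> \<open>The two directions forbid the same pairs, namely marks that differ by 2.\<close>
  moreover have "c (c (j + e) + 2 * - e) \<notin> (\<lambda>j. c (j + e)) ` M" if j: "j \<in> M" for j
  proof
    assume "c (c (j + e) + 2 * - e) \<in> (\<lambda>j. c (j + e)) ` M"
    then have "c (c (j + e) + 2 * - e - e) \<in> M" using shift_mem[OF M_idx] by blast
    moreover have "c (c (j + e) + 2 * - e - e) = c (j - 2 * e)"
      using cyc_cyc_add[of n "j + e" "2 * - e - e"] by (simp add: add_diff_eq)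
    moreover have "c (c (j - 2 * e) + 2 * e) = j"
      using idx_c[OF marks_idx[OF M j]] by simp
    ultimately show False using M j by (auto simp: marks_def)
  qed
  ultimately show ?thesis by (simp add: d.marks_def)
qed

text \<open>The inverse of the shift by \<open>e\<close> is the shift by \<open>- e\<close>, which
  is \<open>shift_marks\<close> in the dual setting.\<close>

lemma sum_marks_shift:
  "(\<Sum>M\<in>pentagram.marks n (\<lambda>j. \<not> p j) (- e) k. g M) = (\<Sum>M\<in>marks k. g ((\<lambda>j. c (j + e)) ` M))"
proof -
  interpret d: pentagram n "\<lambda>j. \<not> p j" "- e" by (rule dual)
  have inv: "(\<lambda>j. c (j - l)) ` (\<lambda>j. c (j + l)) ` M = M" if "M \<subseteq> {1..2 * int n}" for M l
  proof -
    have "(\<lambda>j. c (j - l)) ` (\<lambda>j. c (j + l)) ` M = (\<lambda>j. j) ` M"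
      unfolding image_image by (rule image_cong) (use that in \<open>auto simp: cyc_id\<close>)
    then show ?thesis by simp
  qed
  have sub: "M \<subseteq> {1..2 * int n}" if "M \<in> marks k" for M
    using that by (auto simp: marks_def)
  have dsub: "M \<subseteq> {1..2 * int n}" if "M \<in> d.marks k" for M
    using that by (auto simp: d.marks_def)
  show ?thesis
  proof (rule sum.reindex_bij_witness[where i = "image (\<lambda>j. c (j + e))" and j = "image (\<lambda>j. c (j - e))"])
    fix M assume M: "M \<in> d.marks k"
    show "(\<lambda>j. c (j + e)) ` (\<lambda>j. c (j - e)) ` M = M"
      using inv[OF dsub[OF M], of "- e"] by simp
    then show "g ((\<lambda>j. c (j + e)) ` (\<lambda>j. c (j - e)) ` M) = g M" by simp
    show "(\<lambda>j. c (j - e)) ` M \<in> marks k"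
      using d.shift_marks[OF M] by simp
  next
    fix M assume M: "M \<in> marks k"
    show "(\<lambda>j. c (j - e)) ` (\<lambda>j. c (j + e)) ` M = M" using inv[OF sub[OF M]] .
    show "(\<lambda>j. c (j + e)) ` M \<in> d.marks k" using M by (rule shift_marks)
  qed
qed

lemma hom_mark_sum:
  assumes "unital_hom h" shows "h (mark_sum k x) = mark_sum k (\<lambda>i. h (x i))"
proof -
  interpret unital_hom h by fact
  show ?thesis
    by (simp add: mark_sum_def mult sum prod diff power uminus)
qed

text \<open>Common shape of \<open>alpha1\<close> and \<open>alpha2\<close>: the entries at
  \<open>j\<close> and \<open>j + e\<close>, with \<open>j\<close> of parity \<open>p\<close>, trade
  places and are multiplied by inverse factors. Each map fits it for both parities, with opposite
  \<open>e\<close>. The last conjunct keeps the denominators from vanishing.\<close>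

definition flips :: "(int \<Rightarrow> 'a::field) \<Rightarrow> (int \<Rightarrow> 'a) \<Rightarrow> bool" where
  "flips x y \<longleftrightarrow>
     (\<forall>j\<in>{1..2 * int n}. p j \<longrightarrow>
        y j = x (c (j + e)) *
          ((1 - x (c (j + 2 * e)) * x (c (j + 3 * e))) / (1 - x (c (j - 2 * e)) * x (c (j - e))))) \<and>
     (\<forall>j\<in>{1..2 * int n}. \<not> p j \<longrightarrow>
        y j = x (c (j - e)) *
          ((1 - x (c (j - 2 * e)) * x (c (j - 3 * e))) / (1 - x (c (j + 2 * e)) * x (c (j + e))))) \<and>
     (\<forall>j. p j \<longrightarrow> 1 - x (c j) * x (c (j + e)) \<noteq> 0)"

context
  fixes x y :: "int \<Rightarrow> 'a::field"
  assumes flips: "flips x y"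
begin

definition D :: "int \<Rightarrow> 'a" where
  "D i = 1 - x (c i) * x (c (i + e))"

lemma D_nonzero: "p i \<Longrightarrow> D i \<noteq> 0"
  using flips by (simp add: flips_def D_def)

lemma D_c [simp]: "D (c i + l) = D (i + l)"
  using cyc_cyc_add[of n i "l + e"] by (simp add: D_def add.assoc)

lemma D_c_diff [simp]: "D (c i - l) = D (i - l)"
  using D_c[of i "- l"] by simp

lemma flip_p: "j \<in> idx \<Longrightarrow> y j = x (c (j + e)) * (D (j + 2 * e) / D (j - 2 * e))"
  using flips by (simp add: flips_def D_def algebra_simps)

text \<open>The factors attached to the two entries of a pair are inverse to each other, so the
  product of the pair is unchanged.\<close>

lemma flip_pair:
  assumes j: "j \<in> idx"
  shows "1 - y (c (j - e)) * y (c (j - 2 * e)) = D (j - 2 * e)"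
proof -
  have "y (c (j - 2 * e)) = x (c (c (j - 2 * e) + e)) * (D (c (j - 2 * e) + 2 * e) / D (c (j - 2 * e) + - (2 * e)))"
    using flip_p[of "c (j - 2 * e)"] j c_in[of "j - 2 * e"] by simp
  then have y2: "y (c (j - 2 * e)) = x (c (j - e)) * (D j / D (j - 4 * e))"
    by (simp only: D_c cyc_cyc_add) (simp add: algebra_simps)
  have "y (c (j - e)) = x (c (c (j - e) - e)) *
      ((1 - x (c (c (j - e) - 2 * e)) * x (c (c (j - e) - 3 * e))) /
       (1 - x (c (c (j - e) + 2 * e)) * x (c (c (j - e) + e))))"
    using flips j c_in[of "j - e"] by (simp add: flips_def)
  then have y1: "y (c (j - e)) = x (c (j - 2 * e)) * (D (j - 4 * e) / D j)"
    by (simp only: cyc_cyc_add cyc_cyc_diff) (simp add: D_def algebra_simps)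
  have "j - 2 * e + e = j - e" by simp
  then have "D (j - 2 * e) = 1 - x (c (j - 2 * e)) * x (c (j - e))"
    by (simp only: D_def)
  moreover have "D j \<noteq> 0" "D (j - 4 * e) \<noteq> 0"
    using j D_nonzero by simp_all
  ultimately show ?thesis
    unfolding y1 y2 by (simp add: field_simps)
qed

text \<open>The denominators \<open>D (j - 2 * e)\<close> at free marks cancel against the second
  product. At any other mark \<open>j\<close>, also \<open>c (j - 4 * e)\<close> is a mark, and its
  numerator is the same factor. What survives are the numerators at marks \<open>j\<close> with
  \<open>c (j + 4 * e)\<close> outside \<open>M\<close>, which is freeness in the mirrored
  formula.\<close>

lemma flip_term:
  assumes M: "M \<in> marks k"
  shows "(\<Prod>j\<in>M. y j) * (\<Prod>j\<in>free M. 1 - y (c (j - e)) * y (c (j - 2 * e))) =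
    (\<Prod>j\<in>M. x (c (j + e))) * (\<Prod>j\<in>{j \<in> M. c (j + 4 * e) \<notin> M}. D (j + 2 * e))"
proof -
  let ?R = "{j \<in> M. c (j - 4 * e) \<in> M}" and ?R' = "{j \<in> M. c (j + 4 * e) \<in> M}"
  have fin: "finite M" using M by (rule marks_finite)
  have p: "p j" "c j = j" if "j \<in> M" for j using marks_idx[OF M that] idx_c by blast+
  have "(\<Prod>j\<in>M. y j) = (\<Prod>j\<in>M. x (c (j + e)) * (D (j + 2 * e) / D (j - 2 * e)))"
    by (intro prod.cong refl flip_p marks_idx[OF M])
  then have y: "(\<Prod>j\<in>M. y j) =
      (\<Prod>j\<in>M. x (c (j + e))) * ((\<Prod>j\<in>M. D (j + 2 * e)) / (\<Prod>j\<in>M. D (j - 2 * e)))"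
    by (simp add: prod.distrib prod_dividef)
  have free: "(\<Prod>j\<in>free M. 1 - y (c (j - e)) * y (c (j - 2 * e))) = (\<Prod>j\<in>free M. D (j - 2 * e))"
    by (intro prod.cong refl flip_pair marks_idx[OF M]) (use free_subset in blast)
  have "(\<Prod>j\<in>M. D (j - 2 * e)) = (\<Prod>j\<in>M - free M. D (j - 2 * e)) * (\<Prod>j\<in>free M. D (j - 2 * e))"
    using fin free_subset by (intro prod.subset_diff)
  also have "M - free M = ?R" by (auto simp: free_def)
  also have "(\<Prod>j\<in>?R. D (j - 2 * e)) = (\<Prod>j\<in>?R'. D (j + 2 * e))"
    by (rule prod.reindex_bij_witness[where i = "\<lambda>j. c (j + 4 * e)" and j = "\<lambda>j. c (j - 4 * e)"])
       (auto simp: p)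
  finally have denom: "(\<Prod>j\<in>M. D (j - 2 * e)) = (\<Prod>j\<in>?R'. D (j + 2 * e)) * (\<Prod>j\<in>free M. D (j - 2 * e))" .
  have "(\<Prod>j\<in>M. D (j + 2 * e)) = (\<Prod>j\<in>M - ?R'. D (j + 2 * e)) * (\<Prod>j\<in>?R'. D (j + 2 * e))"
    using fin by (intro prod.subset_diff) auto
  also have "M - ?R' = {j \<in> M. c (j + 4 * e) \<notin> M}" by auto
  finally have num: "(\<Prod>j\<in>M. D (j + 2 * e)) =
      (\<Prod>j\<in>{j \<in> M. c (j + 4 * e) \<notin> M}. D (j + 2 * e)) * (\<Prod>j\<in>?R'. D (j + 2 * e))" .
  have nz: "(\<Prod>j\<in>?R'. D (j + 2 * e)) \<noteq> 0" "(\<Prod>j\<in>free M. D (j - 2 * e)) \<noteq> 0"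
    using fin finite_free[OF M] D_nonzero p(1) free_subset[of M] by (auto simp: prod_zero_iff)
  show ?thesis
    unfolding y free num denom using nz by simp
qed

lemma mark_sum_flip: "mark_sum k y = pentagram.mark_sum n (\<lambda>j. \<not> p j) (- e) k x"
proof -
  interpret d: pentagram n "\<lambda>j. \<not> p j" "- e" by (rule dual)
  have "(\<Prod>j\<in>M. y j) * (\<Prod>j\<in>free M. 1 - y (c (j - e)) * y (c (j - 2 * e))) =
      (\<Prod>j\<in>(\<lambda>j. c (j + e)) ` M. x j) *
      (\<Prod>j\<in>d.free ((\<lambda>j. c (j + e)) ` M). 1 - x (c (j - - e)) * x (c (j - 2 * - e)))"
    if M: "M \<in> marks k" for M
  proof -
    have M_idx: "M \<subseteq> idx" using M by (simp add: marks_def)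
    have mem: "c (c (j + e) - 4 * - e) \<in> (\<lambda>j. c (j + e)) ` M \<longleftrightarrow> c (j + 4 * e) \<in> M" for j
    proof -
      have "c (c (j + e) - 4 * - e) = c (j + 5 * e)" by (simp add: algebra_simps)
      then show ?thesis using shift_mem[OF M_idx, of "j + 5 * e" e] by (simp add: algebra_simps)
    qed
    \<comment> \<open>Freeness of \<open>j + e\<close> in the dual setting looks at
      \<open>j + 5 * e\<close>, the shift of \<open>j + 4 * e\<close>; so the set left over in
      \<open>flip_term\<close> appears.\<close>
    have "d.free ((\<lambda>j. c (j + e)) ` M) = (\<lambda>j. c (j + e)) ` {j \<in> M. c (j + 4 * e) \<notin> M}"
      using mem unfolding d.free_def by blast
    moreover have "inj_on (\<lambda>j. c (j + e)) {j \<in> M. c (j + 4 * e) \<notin> M}"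
      by (rule shift_inj) (use M_idx in blast)
    moreover have "1 - x (c (c (j + e) - - e)) * x (c (c (j + e) - 2 * - e)) = D (j + 2 * e)" for j
    proof -
      have "j + e - - e = j + 2 * e" "j + e - 2 * - e = j + 2 * e + e" by simp_all
      then show ?thesis by (simp only: D_def cyc_cyc_diff)
    qed
    ultimately show ?thesis
      using shift_inj[OF M_idx, of e] flip_term[OF M] by (simp only: prod.reindex o_def)
  qed
  then show ?thesis
    unfolding mark_sum_def d.mark_sum_def sum_marks_shift
    by (intro arg_cong[of _ _ "\<lambda>s. (- 1) ^ k * s"] sum.cong refl)
qed

text \<open>Over all indices of parity \<open>p\<close>, numerators and denominators run through the
  same factors, shifted by 4 places.\<close>

lemma full_prod_flip: "(\<Prod>j\<in>idx. y j) = (\<Prod>j\<in>{j \<in> {1..2 * int n}. \<not> p j}. x j)"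
proof -
  have fin: "finite idx" by (rule finite_idx)
  have "(\<Prod>j\<in>idx. y j) = (\<Prod>j\<in>idx. x (c (j + e)) * (D (j + 2 * e) / D (j - 2 * e)))"
    by (intro prod.cong refl flip_p)
  also have "\<dots> = (\<Prod>j\<in>idx. x (c (j + e))) * ((\<Prod>j\<in>idx. D (j + 2 * e)) / (\<Prod>j\<in>idx. D (j - 2 * e)))"
    by (simp add: prod.distrib prod_dividef)
  also have "(\<Prod>j\<in>idx. D (j + 2 * e)) = (\<Prod>j\<in>idx. D (j - 2 * e))"
    by (rule prod.reindex_bij_witness[where i = "\<lambda>j. c (j - 4 * e)" and j = "\<lambda>j. c (j + 4 * e)"])
       (use c_in in \<open>auto simp: cyc_id add.commute[of "2 * e"]\<close>)
  also have "(\<Prod>j\<in>idx. D (j - 2 * e)) \<noteq> 0"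
    using fin D_nonzero by auto
  then have "(\<Prod>j\<in>idx. D (j - 2 * e)) / (\<Prod>j\<in>idx. D (j - 2 * e)) = 1" by (rule divide_self)
  also have "(\<Prod>j\<in>idx. x (c (j + e))) = (\<Prod>j\<in>{j \<in> {1..2 * int n}. \<not> p j}. x j)"
    by (rule prod.reindex_bij_witness[where i = "\<lambda>j. c (j - e)" and j = "\<lambda>j. c (j + e)"])
       (use c_in in \<open>auto simp: cyc_id\<close>)
  finally show ?thesis by simp
qed

end

text \<open>The formula for direction \<open>e\<close> at \<open>y\<close> meets the formula for
  opposite parity and direction \<open>- e\<close> at \<open>x\<close>; for \<open>k = n\<close> the
  full products are compared.\<close>

lemma subst_pentagram_inv_flip:
  fixes h :: "complex \<Rightarrow> 'a::field"
  assumes h: "coeff_hom h" and flips: "flips x y" and k: "k > 0"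
  shows "subst h y (pentagram_inv n p k) = subst h x (pentagram_inv n (\<lambda>j. \<not> p j) k)"
proof -
  interpret coeff_hom h by (rule h)
  interpret d: pentagram n "\<lambda>j. \<not> p j" "- e" by (rule dual)
  show ?thesis
  proof (cases "k = n")
    case True
    then show ?thesis
      using full_prod_flip[OF flips] by (simp add: pentagram_inv_def subst.prod)
  next
    case False
    then show ?thesis
      using k mark_sum_flip[OF flips, of k]
      by (simp add: pentagram_inv_marks d.pentagram_inv_marks hom_mark_sum[OF subst.unital_hom_axioms]
          d.hom_mark_sum[OF subst.unital_hom_axioms])
  qed
qed

end

subsection \<open>Invariance under \<open>alpha\<close>\<close>

lemma pentagram_odd: "n \<ge> 3 \<Longrightarrow> e = 1 \<or> e = - 1 \<Longrightarrow> pentagram n odd e"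
  and pentagram_even: "n \<ge> 3 \<Longrightarrow> e = 1 \<or> e = - 1 \<Longrightarrow> pentagram n even e"
  by unfold_locales auto

text \<open>The same map is a flip in two ways, read from the odd or from the even entries; the
  first serves the \<open>O\<close>-invariants, the second the \<open>E\<close>-invariants.\<close>

lemma alpha1_flips:
  fixes x :: "int \<Rightarrow> 'a::field"
  assumes n: "n \<ge> 3" and nz: "\<And>j. odd j \<Longrightarrow> 1 - x (cyc n j) * x (cyc n (j + 1)) \<noteq> 0"
  shows "pentagram.flips n odd 1 x (alpha1 n x)" "pentagram.flips n even (- 1) x (alpha1 n x)"
proof -
  have odd: "alpha1 n x j = x (cyc n (j + 1)) * ((1 - x (cyc n (j + 2)) * x (cyc n (j + 3))) /
      (1 - x (cyc n (j - 2)) * x (cyc n (j - 1))))" if "odd j" for j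
    using that by (elim oddE) (simp add: alpha1_def Let_def algebra_simps)
  have even: "alpha1 n x j = x (cyc n (j - 1)) * ((1 - x (cyc n (j - 2)) * x (cyc n (j - 3))) /
      (1 - x (cyc n (j + 2)) * x (cyc n (j + 1))))" if "even j" for j
    using that by (elim evenE) (simp add: alpha1_def Let_def algebra_simps)
  show "pentagram.flips n odd 1 x (alpha1 n x)"
    using nz by (simp add: pentagram.flips_def[OF pentagram_odd[OF n]] odd even)
  show "pentagram.flips n even (- 1) x (alpha1 n x)"
    using nz[of "j - 1" for j]
    by (simp add: pentagram.flips_def[OF pentagram_even[OF n]] odd even mult.commute)
qed

lemma alpha2_flips:
  fixes x :: "int \<Rightarrow> 'a::field"
  assumes n: "n \<ge> 3" and nz: "\<And>j. even j \<Longrightarrow> 1 - x (cyc n j) * x (cyc n (j + 1)) \<noteq> 0"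
  shows "pentagram.flips n even 1 x (alpha2 n x)" "pentagram.flips n odd (- 1) x (alpha2 n x)"
proof -
  have even: "alpha2 n x j = x (cyc n (j + 1)) * ((1 - x (cyc n (j + 2)) * x (cyc n (j + 3))) /
      (1 - x (cyc n (j - 2)) * x (cyc n (j - 1))))" if "even j" for j
    using that by (elim evenE) (simp add: alpha2_def Let_def algebra_simps)
  have odd: "alpha2 n x j = x (cyc n (j - 1)) * ((1 - x (cyc n (j - 2)) * x (cyc n (j - 3))) /
      (1 - x (cyc n (j + 2)) * x (cyc n (j + 1))))" if "odd j" for j
    using that by (elim oddE) (simp add: alpha2_def Let_def algebra_simps)
  show "pentagram.flips n even 1 x (alpha2 n x)"
    using nz by (simp add: pentagram.flips_def[OF pentagram_even[OF n]] odd even)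
  show "pentagram.flips n odd (- 1) x (alpha2 n x)"
    using nz[of "j - 1" for j]
    by (simp add: pentagram.flips_def[OF pentagram_odd[OF n]] odd even mult.commute)
qed

lemma coeff_hom_fract: "coeff_hom (\<lambda>c. to_fract (Const c :: int cpoly))"
proof -
  interpret c: coeff_hom "Const :: complex \<Rightarrow> int cpoly" by (rule coeff_hom_Const)
  show ?thesis by unfold_locales (simp_all add: c.add c.mult)
qed

lemma neq_by_constant_term: "subst (\<lambda>c. [:c:]) (\<lambda>_. 0) P \<noteq> subst (\<lambda>c. [:c:]) (\<lambda>_. 0) Q \<Longrightarrow> P \<noteq> Q"
  by auto

lemma generic_nonzero: "1 - generic_point i * generic_point j \<noteq> 0"
proof -
  interpret coeff_hom "\<lambda>c::complex. [:c:]" by (rule coeff_hom_pCons)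
  have "1 - Var i * Var j \<noteq> (0 :: int cpoly)"
    by (rule neq_by_constant_term) (simp add: subst.diff subst.mult)
  then have "to_fract (1 - Var i * Var j :: int cpoly) \<noteq> 0" by (simp only: to_fract_eq_0_iff not_False_eq_True)
  then show ?thesis by (simp add: generic_point_def)
qed

text \<open>This lets \<open>alpha1\<close> be a flip at the image of the generic point under
  \<open>alpha2\<close>. After clearing denominators, a zero would mean equality of a polynomial
  with constant term 1 and one with constant term 0.\<close>

lemma alpha2_generic_nonzero:
  assumes n: "n \<ge> 3" and j: "odd j"
  shows "1 - alpha2 n generic_point (cyc n j) * alpha2 n generic_point (cyc n (j + 1)) \<noteq> 0"
proof -
  have idx: "cyc n j \<in> {j \<in> {1..2 * int n}. odd j}" "cyc n (j + 1) \<in> {j \<in> {1..2 * int n}. even j}"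
    using n j cyc_in[of n] by (auto simp: even_cyc)
  interpret e: pentagram n even 1 by (rule pentagram_even) (use n in simp_all)
  interpret o: pentagram n odd "- 1" by (rule pentagram_odd) (use n in simp_all)
  interpret coeff_hom "\<lambda>c::complex. [:c:]" by (rule coeff_hom_pCons)
  let ?x = generic_point
  note fl = alpha2_flips[where x = generic_point, OF n generic_nonzero]
  define d where "d k l = (1 - Var (cyc n k) * Var (cyc n l) :: int cpoly)" for k l
  have "to_fract (d k l) = 1 - ?x (cyc n k) * ?x (cyc n l)" for k l
    by (simp add: d_def generic_point_def)
  then have nz: "to_fract (d k l) \<noteq> 0" and D: "e.D ?x k = to_fract (d k (k + 1))" "o.D ?x k = to_fract (d k (k - 1))" for k l
    using generic_nonzero by (simp_all add: e.D_def[OF fl(1)] o.D_def[OF fl(2)])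
  \<comment> \<open>The odd entry comes from the flip with \<open>odd\<close> and
    \<open>- 1\<close>, the even entry from the one with \<open>even\<close> and
    \<open>1\<close>.\<close>
  have "alpha2 n ?x (cyc n j) = ?x (cyc n (cyc n j + - 1)) * (o.D ?x (cyc n j + 2 * - 1) / o.D ?x (cyc n j - 2 * - 1))"
    by (rule o.flip_p[OF fl(2) idx(1)])
  then have a1: "alpha2 n ?x (cyc n j) =
      to_fract (Var (cyc n (j + - 1))) * (to_fract (d (j - 2) (j - 3)) / to_fract (d (j + 2) (j + 1)))"
    by (simp only: o.D_c[OF fl(2)] o.D_c_diff[OF fl(2)] cyc_cyc_add) (simp add: D generic_point_def add.commute[of 1])
  have "alpha2 n ?x (cyc n (j + 1)) = ?x (cyc n (cyc n (j + 1) + 1)) *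
      (e.D ?x (cyc n (j + 1) + 2 * 1) / e.D ?x (cyc n (j + 1) - 2 * 1))"
    by (rule e.flip_p[OF fl(1) idx(2)])
  then have a2: "alpha2 n ?x (cyc n (j + 1)) =
      to_fract (Var (cyc n (j + 2))) * (to_fract (d (j + 3) (j + 4)) / to_fract (d (j - 1) j))"
    by (simp only: e.D_c[OF fl(1)] e.D_c_diff[OF fl(1)] cyc_cyc_add) (simp add: D generic_point_def add.assoc)
  have cross: "Q * S = a * b * (P * R)" if "1 - a * (P / Q) * (b * (R / S)) = 0" "Q \<noteq> 0" "S \<noteq> 0"
    for a b P Q R S :: "int cpoly fract"
    using that by (simp add: field_simps)
  show ?thesis
  proof
    assume "1 - alpha2 n ?x (cyc n j) * alpha2 n ?x (cyc n (j + 1)) = 0"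
    then have "to_fract (d (j + 2) (j + 1)) * to_fract (d (j - 1) j) =
        to_fract (Var (cyc n (j + - 1))) * to_fract (Var (cyc n (j + 2))) *
        (to_fract (d (j - 2) (j - 3)) * to_fract (d (j + 3) (j + 4)))"
      unfolding a1 a2 using nz nz by (rule cross)
    then have "d (j + 2) (j + 1) * d (j - 1) j =
        Var (cyc n (j + - 1)) * Var (cyc n (j + 2)) * (d (j - 2) (j - 3) * d (j + 3) (j + 4))"
      by (simp only: to_fract_eq_iff flip: to_fract_mult)
    moreover have "d (j + 2) (j + 1) * d (j - 1) j \<noteq>
        Var (cyc n (j + - 1)) * Var (cyc n (j + 2)) * (d (j - 2) (j - 3) * d (j + 3) (j + 4))"
      by (rule neq_by_constant_term) (simp add: subst.diff subst.mult d_def)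
    ultimately show False by contradiction
  qed
qed

text \<open>One of the two maps leads to the invariant of the other family, and the second leads
  back.\<close>

lemma alpha_invariant_pentagram_inv:
  assumes n: "n \<ge> 3" and p: "p = odd \<or> p = even" and k: "k > 0"
  shows "alpha_invariant n (pentagram_inv n p k)"
proof -
  let ?h = "\<lambda>c. to_fract (Const c :: int cpoly)" and ?y = "alpha2 n generic_point"
  interpret f: unital_hom "to_fract :: int cpoly \<Rightarrow> _" by unfold_locales simp_all
  have odd: "(\<lambda>j::int. \<not> odd j) = even" by (simp add: fun_eq_iff)
  note nz = alpha2_generic_nonzero[OF n]
  have "subst ?h (alpha1 n ?y) (pentagram_inv n p k) = subst ?h ?y (pentagram_inv n (\<lambda>j. \<not> p j) k)"
    using p pentagram.subst_pentagram_inv_flip[OF pentagram_odd[OF n] coeff_hom_fract alpha1_flips(1)[where x = ?y, OF n nz] k]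
      pentagram.subst_pentagram_inv_flip[OF pentagram_even[OF n] coeff_hom_fract alpha1_flips(2)[where x = ?y, OF n nz] k]
    by auto
  also have "\<dots> = subst ?h generic_point (pentagram_inv n p k)"
    using p odd
      pentagram.subst_pentagram_inv_flip[OF pentagram_odd[OF n] coeff_hom_fract alpha2_flips(2)[where x = generic_point, OF n generic_nonzero] k]
      pentagram.subst_pentagram_inv_flip[OF pentagram_even[OF n] coeff_hom_fract alpha2_flips(1)[where x = generic_point, OF n generic_nonzero] k]
    by auto
  also have "\<dots> = to_fract (subst Const Var (pentagram_inv n p k))"
    unfolding f.hom_subst generic_point_def ..
  finally show ?thesis
    by (simp add: alpha_invariant_def alpha_def o_def)
qed

subsection \<open>Orders of the invariants along a monomial curve\<close>

text \<open>
  The entry at position \<open>r\<close> among the variables with parity offset \<open>t\<close>. The positions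
  \<open>0, 2, \<dots>, 2(m - 1)\<close>, \<open>m = n div 2\<close>, carry the smallest weights, with partial sums
  \<open>B\<^bsup>2k + t\<^esup>\<close>; position 1 brings the total weight to \<open>B\<^bsup>2n + t\<^esup>\<close>.
\<close>

definition position_weight :: "nat \<Rightarrow> nat \<Rightarrow> nat \<Rightarrow> nat \<Rightarrow> nat" where
  "position_weight n B t r =
     (if even r \<and> r < 2 * (n div 2) then (if r = 0 then B ^ (2 + t) else B ^ (r + 2 + t) - B ^ (r + t))
      else if r = 1
        then B ^ (2 * n + t) - B ^ (2 * (n div 2) + t) - (n - n div 2 - 1) * B ^ (2 * (n div 2) + 1 + t)
      else B ^ (2 * (n div 2) + 1 + t))"

text \<open>The index at position \<open>r\<close> is \<open>2 * r + 1 + t\<close>, and for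
  \<open>t\<close> equal to 0 or 1 the division recovers \<open>r\<close>. Through \<open>t\<close>
  the odd variables yield even powers of \<open>B\<close> and the even variables odd powers.\<close>

definition curve_weight :: "nat \<Rightarrow> nat \<Rightarrow> int \<Rightarrow> nat" where
  "curve_weight n B j = position_weight n B (if odd j then 0 else 1) (nat ((j - 1) div 2))"

section \<open>Sums and comparison of the weights\<close>

lemma position_weight_even:
  "i < n div 2 \<Longrightarrow> position_weight n B t (2 * i) =
     (if i = 0 then B ^ (2 + t) else B ^ (2 * i + 2 + t) - B ^ (2 * i + t))"
  by (simp add: position_weight_def)

text \<open>The sum telescopes; the truncated subtractions are genuine because the powers of
  \<open>B\<close> increase.\<close>

lemma sum_position_weight_even:
  assumes "0 < k" "k \<le> n div 2" "B > 0"
  shows "(\<Sum>i<k. position_weight n B t (2 * i)) = B ^ (2 * k + t)"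
  using assms
proof (induction k)
  case (Suc k)
  show ?case
  proof (cases "k = 0")
    case False
    have "B ^ (2 * k + t) \<le> B ^ (2 * k + 2 + t)"
      using Suc.prems by (intro power_increasing) auto
    then show ?thesis
      using Suc False by (simp add: position_weight_even)
  qed (use Suc.prems position_weight_even[of 0 n B t] in simp)
qed simp

text \<open>This makes the subtractions in the weight of position 1 genuine. The factor
  \<open>n - n div 2\<close> exceeds the one subtracted there by 1, and the spare power is the lower
  bound for that weight in \<open>position_weight_other\<close>.\<close>

lemma position_weight_other_sum:
  assumes n: "n \<ge> 3" and B: "B \<ge> n + 2"
  shows "B ^ (2 * (n div 2) + t) + (n - n div 2) * B ^ (2 * (n div 2) + 1 + t) \<le> B ^ (2 * n + t)"
proof -
  let ?C = "B ^ (2 * (n div 2) + 1 + t)"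
  have "B ^ (2 * (n div 2) + t) \<le> ?C"
    using B by (intro power_increasing) auto
  then have "B ^ (2 * (n div 2) + t) + (n - n div 2) * ?C \<le> (1 + (n - n div 2)) * ?C"
    by simp
  also have "\<dots> \<le> B * ?C"
    using B by (intro mult_right_mono) auto
  also have "\<dots> = B ^ (2 * (n div 2) + 2 + t)" by simp
  also have "\<dots> \<le> B ^ (2 * n + t)"
    using n B by (intro power_increasing) auto
  finally show ?thesis .
qed

lemma position_weight_other:
  assumes n: "n \<ge> 3" and B: "B \<ge> n + 2" and r: "\<not> (even r \<and> r < 2 * (n div 2))"
  shows "B ^ (2 * (n div 2) + 1 + t) \<le> position_weight n B t r"
proof (cases "r = 1")
  case True
  have "n - n div 2 = Suc (n - n div 2 - 1)" using n by simp
  then have "(n - n div 2) * B ^ (2 * (n div 2) + 1 + t)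
      = B ^ (2 * (n div 2) + 1 + t) + (n - n div 2 - 1) * B ^ (2 * (n div 2) + 1 + t)"
    by (metis mult_Suc)
  moreover have "position_weight n B t r =
      B ^ (2 * n + t) - B ^ (2 * (n div 2) + t) - (n - n div 2 - 1) * B ^ (2 * (n div 2) + 1 + t)"
    using True by (simp add: position_weight_def)
  ultimately show ?thesis
    using position_weight_other_sum[OF n B, of t] by linarith
qed (use r in \<open>auto simp: position_weight_def\<close>)

text \<open>The number \<open>B ^ (2 * k + t)\<close> separates the two sides: the first
  \<open>k\<close> even positions do not exceed it, and every other position does.\<close>

lemma position_weight_less:
  assumes n: "n \<ge> 3" and B: "B \<ge> n + 2" and k: "k \<le> n div 2" and i: "i < k"
    and r: "r \<notin> (\<lambda>i. 2 * i) ` {..<k}"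
  shows "position_weight n B t (2 * i) < position_weight n B t r"
proof -
  have i_le: "position_weight n B t (2 * i) \<le> B ^ (2 * k + t)"
  proof -
    have "position_weight n B t (2 * i) \<le> B ^ (2 * i + 2 + t)"
      using i k by (auto simp: position_weight_even)
    also have "\<dots> \<le> B ^ (2 * k + t)"
      using i B by (intro power_increasing) auto
    finally show ?thesis .
  qed
  show ?thesis
  proof (cases "even r \<and> r < 2 * (n div 2)")
    case True
    then obtain l where l: "r = 2 * l" "l < n div 2" by auto
    then have "k \<le> l" using r by (auto simp: not_less[symmetric])
    then have "l \<noteq> 0" using i by simp
    have "3 * 1 \<le> B * B" using B n by (intro mult_mono) auto
    then have "3 * B ^ (2 * l + t) \<le> B ^ (2 * l + 2 + t)"
      by (simp add: power_add power2_eq_square)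
    moreover have "B ^ (2 * l + t) > 0" using B by simp
    moreover have "position_weight n B t r = B ^ (2 * l + 2 + t) - B ^ (2 * l + t)"
      using position_weight_even[OF l(2)] l(1) \<open>l \<noteq> 0\<close> by simp
    ultimately have "B ^ (2 * l + t) < position_weight n B t r"
      by linarith
    moreover have "B ^ (2 * k + t) \<le> B ^ (2 * l + t)"
      using \<open>k \<le> l\<close> B by (intro power_increasing) auto
    ultimately show ?thesis using i_le by linarith
  next
    case False
    have "B ^ (2 * k + t) < B ^ (2 * (n div 2) + 1 + t)"
      using k B by (intro power_strict_increasing) auto
    then show ?thesis using i_le position_weight_other[OF n B False, of t] by linarith
  qed
qed

text \<open>Positive weights give every factor of the product over \<open>free M\<close> the value 1
  at 0.\<close>

lemma position_weight_pos:
  assumes n: "n \<ge> 3" and B: "B \<ge> n + 2"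
  shows "position_weight n B t r > 0"
proof (cases "even r \<and> r < 2 * (n div 2)")
  case True
  have "B ^ (r + t) < B ^ (r + 2 + t)"
    using B by (intro power_strict_increasing) auto
  then show ?thesis using True B by (simp add: position_weight_def)
next
  case False
  have "0 < B ^ (2 * (n div 2) + 1 + t)" using B by simp
  then show ?thesis using position_weight_other[OF n B False, of t] by linarith
qed

lemma sum_position_weight:
  assumes n: "n \<ge> 3" and B: "B \<ge> n + 2"
  shows "(\<Sum>r<n. position_weight n B t r) = B ^ (2 * n + t)"
proof -
  let ?m = "n div 2" and ?w = "position_weight n B t"
  let ?C = "B ^ (2 * ?m + 1 + t)" and ?E = "(\<lambda>i. 2 * i) ` {..<?m}"
  have E: "?E \<subseteq> {..<n}" "1 \<in> {..<n} - ?E" using n by (auto simp: image_iff)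
  \<comment> \<open>For odd \<open>n\<close> the last position \<open>n - 1\<close> is even but
    equals \<open>2 * (n div 2)\<close>, so it is not among the light ones.\<close>
  have other: "\<not> (even r \<and> r < 2 * ?m)" if "r \<in> {..<n} - ?E" for r
    using that by (auto elim!: evenE)
  have card: "card ({..<n} - ?E - {1}) = n - ?m - 1"
    using E by (simp add: card_Diff_subset card_image inj_on_def)
  have "(\<Sum>r<n. ?w r) = (\<Sum>r\<in>{..<n} - ?E. ?w r) + (\<Sum>r\<in>?E. ?w r)"
    using E by (intro sum.subset_diff) auto
  also have "(\<Sum>r\<in>?E. ?w r) = B ^ (2 * ?m + t)"
    using sum_position_weight_even[of ?m n B t] n B by (simp add: sum.reindex inj_on_def)
  also have "(\<Sum>r\<in>{..<n} - ?E. ?w r) = ?w 1 + (\<Sum>r\<in>{..<n} - ?E - {1}. ?w r)"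
    using E(2) by (intro sum.remove) auto
  also have "(\<Sum>r\<in>{..<n} - ?E - {1}. ?w r) = (\<Sum>r\<in>{..<n} - ?E - {1}. ?C)"
    using other by (intro sum.cong refl) (auto simp: position_weight_def)
  also have "\<dots> = (n - ?m - 1) * ?C" using card by simp
  also have "?w 1 + (n - ?m - 1) * ?C + B ^ (2 * ?m + t) = B ^ (2 * n + t)"
  proof -
    have "(n - ?m - 1) * ?C \<le> (n - ?m) * ?C" by (intro mult_right_mono) auto
    moreover have "?w 1 = B ^ (2 * n + t) - B ^ (2 * ?m + t) - (n - ?m - 1) * ?C"
      by (simp add: position_weight_def)
    ultimately show ?thesis
      using position_weight_other_sum[OF n B, of t] by linarith
  qed
  finally show ?thesis .
qed

section \<open>Lowest terms along the curve\<close>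

context pentagram
begin

text \<open>Any other mark set of the same size trades some elements of \<open>M0\<close> for
  heavier indices, so its term has higher order. The value of \<open>g\<close> at 0 therefore comes
  from \<open>M0\<close> alone and is a sign.\<close>

lemma curve_order:
  assumes k: "k > 0" "k \<noteq> n" and M0: "M0 \<in> marks k" and w: "\<And>j. w j > (0::nat)"
    and less: "\<And>i j. i \<in> M0 \<Longrightarrow> j \<in> idx - M0 \<Longrightarrow> w i < w j"
  shows "\<exists>g. subst (\<lambda>c. [:c:]) (\<lambda>j. monom 1 (w j)) (pentagram_inv n p k) = monom 1 (sum w M0) * g \<and>
    poly g 0 \<noteq> 0"
proof -
  interpret coeff_hom "\<lambda>c::complex. [:c:]" by (rule coeff_hom_pCons)
  let ?x = "\<lambda>j. monom 1 (w j) :: complex poly"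
  define H where "H M = (\<Prod>j\<in>free M. 1 - ?x (c (j - e)) * ?x (c (j - 2 * e)))" for M
  define g where "g = (- 1) ^ k * (\<Sum>M\<in>marks k. monom 1 (sum w M - sum w M0) * H M)"
  have fin0: "finite M0" using M0 by (rule marks_finite)
  have min: "sum w M0 < sum w M" if M: "M \<in> marks k" "M \<noteq> M0" for M
  proof -
    have fin: "finite M" using M(1) by (rule marks_finite)
    have cards: "card M = card M0" using M(1) M0 by (simp add: marks_def)
    then have ne: "M - M0 \<noteq> {}" "M0 - M \<noteq> {}"
      using M(2) fin fin0 card_subset_eq[of M0 M] card_subset_eq[of M M0] by auto
    have card_diff: "card (M - M0) = card (M0 - M)"
      using cards fin fin0 card_Diff_subset_Int[of M M0] card_Diff_subset_Int[of M0 M]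
      by (simp add: Int_commute)
    \<comment> \<open>Even the largest weight in \<open>M0 - M\<close> lies below every weight in
      \<open>M - M0\<close>, and both differences have the same size.\<close>
    define \<theta> where "\<theta> = Max (w ` (M0 - M))"
    obtain i where i: "i \<in> M0 - M" "w i = \<theta>"
    proof -
      have "\<theta> \<in> w ` (M0 - M)" unfolding \<theta>_def using ne(2) fin0 by (intro Max_in) auto
      then show ?thesis using that by auto
    qed
    have "sum w (M0 - M) \<le> (\<Sum>j\<in>M0 - M. \<theta>)"
      using fin0 by (intro sum_mono) (auto simp: \<theta>_def)
    also have "\<dots> = (\<Sum>j\<in>M - M0. \<theta>)" using card_diff by simp
    also have "\<dots> < sum w (M - M0)"
      using ne(1) fin i less[of i] marks_idx[OF M(1)] by (intro sum_strict_mono) auto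
    finally show ?thesis
      using sum.Int_Diff[OF fin, of w M0] sum.Int_Diff[OF fin0, of w M] by (simp add: Int_commute)
  qed
  have H0: "poly (H M) 0 = 1" for M
    using w by (simp add: H_def poly_prod poly_monom zero_power)
  have "subst (\<lambda>c. [:c:]) ?x (pentagram_inv n p k) = mark_sum k ?x"
    using k by (simp add: pentagram_inv_marks hom_mark_sum[OF subst.unital_hom_axioms])
  also have "\<dots> = (- 1) ^ k * (\<Sum>M\<in>marks k. monom 1 (sum w M) * H M)"
  proof -
    have "(\<Prod>j\<in>M. ?x j) = monom 1 (sum w M)" if "M \<in> marks k" for M
      using marks_finite[OF that] by (induction M rule: finite_induct) (simp_all add: mult_monom)
    then show ?thesis by (simp add: mark_sum_def H_def)
  qed
  also have "(\<Sum>M\<in>marks k. monom 1 (sum w M) * H M) =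
      (\<Sum>M\<in>marks k. monom 1 (sum w M0) * (monom 1 (sum w M - sum w M0) * H M))"
  proof (intro sum.cong refl)
    fix M assume "M \<in> marks k"
    then have "sum w M0 \<le> sum w M" using min by (cases "M = M0") (auto intro: less_imp_le)
    then show "monom 1 (sum w M) * H M = monom 1 (sum w M0) * (monom 1 (sum w M - sum w M0) * H M)"
      by (simp add: mult_monom flip: mult.assoc)
  qed
  also have "(- 1) ^ k * \<dots> = monom 1 (sum w M0) * g"
    by (simp add: g_def sum_distrib_left mult_ac)
  finally have "subst (\<lambda>c. [:c:]) ?x (pentagram_inv n p k) = monom 1 (sum w M0) * g" .
  moreover have "poly g 0 = (- 1) ^ k * (\<Sum>M\<in>marks k. if M = M0 then 1 else 0)"
  proof -
    have "poly (monom 1 (sum w M - sum w M0) * H M) 0 = (if M = M0 then 1 else 0)" if "M \<in> marks k" for M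
      using min[OF that] by (auto simp: poly_monom H0)
    then show ?thesis by (simp add: g_def poly_sum poly_power)
  qed
  then have "poly g 0 \<noteq> 0" using M0 finite_marks by simp
  ultimately show ?thesis by blast
qed

lemma pentagram_inv_order:
  assumes e1: "e = 1" and k: "k \<in> inv_indices n" and B: "B \<ge> n + 2"
    and t: "t = (if p 1 then 0 else 1)"
  shows "\<exists>g. subst (\<lambda>c. [:c:]) (\<lambda>j. monom 1 (curve_weight n B j)) (pentagram_inv n p k) =
    monom 1 (B ^ (2 * k + t)) * g \<and> poly g 0 \<noteq> 0"
proof -
  interpret coeff_hom "\<lambda>c::complex. [:c:]" by (rule coeff_hom_pCons)
  define pos where "pos r = 2 * int r + 1 + int t" for r
  have inj: "inj pos" by (auto simp: inj_def pos_def)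
  have t_le: "t \<le> 1" using t by simp
  have p_pos: "p j \<longleftrightarrow> (\<exists>l. j = 2 * l + 1 + int t)" for j
    using p t by (auto elim!: oddE evenE) presburger+
  have idx: "idx = pos ` {..<n}"
  proof (intro set_eqI iffI)
    fix j assume j: "j \<in> idx"
    then obtain l where "j = 2 * l + 1 + int t" using p_pos by auto
    then have "j = pos (nat l)" "nat l < n" using j t_le by (auto simp: pos_def)
    then show "j \<in> pos ` {..<n}" by blast
  next
    fix j assume "j \<in> pos ` {..<n}"
    then show "j \<in> idx" using p_pos t_le by (auto simp: pos_def)
  qed
  have weight: "curve_weight n B (pos r) = position_weight n B t r" for r
  proof -
    have "odd (pos r) \<longleftrightarrow> t = 0" using t by (auto simp: pos_def)
    moreover have "nat ((pos r - 1) div 2) = r" using t_le by (simp add: pos_def)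
    moreover have "t = 0 \<or> t = 1" using t by simp
    ultimately show ?thesis by (auto simp: curve_weight_def)
  qed
  show ?thesis
  proof (cases "k = n")
    case True
    have "(\<Prod>j\<in>A. monom 1 (curve_weight n B j)) = (monom 1 (\<Sum>j\<in>A. curve_weight n B j) :: complex poly)"
      if "finite A" for A
      using that by (induction A rule: finite_induct) (simp_all add: mult_monom)
    from this[OF finite_idx] have "subst (\<lambda>c. [:c:]) (\<lambda>j. monom 1 (curve_weight n B j)) (pentagram_inv n p k) =
        monom 1 (\<Sum>j\<in>idx. curve_weight n B j)"
      using True by (simp add: pentagram_inv_def subst.prod)
    also have "(\<Sum>j\<in>idx. curve_weight n B j) = B ^ (2 * k + t)"
      unfolding idx using sum_position_weight[OF n B] True
      by (simp add: sum.reindex inj_on_subset[OF inj] weight)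
    finally show ?thesis by (intro exI[of _ 1]) simp
  next
    case False
    then have k: "0 < k" "k \<le> n div 2" using k by (auto simp: inv_indices_def)
    \<comment> \<open>Positions 0, 2, ..., 2(k - 1), the lightest by
      \<open>position_weight_less\<close>. Since \<open>k \<le> n div 2\<close>, the successor of
      each is an odd position below \<open>n\<close>, so no two marks clash across the cyclic
      end.\<close>
    define M0 where "M0 = (\<lambda>i. pos (2 * i)) ` {..<k}"
    have inj2: "inj_on (\<lambda>i. pos (2 * i)) {..<k}" by (auto simp: inj_on_def pos_def)
    have "c (pos (2 * i) + 2 * e) \<notin> M0" if "i < k" for i
    proof -
      have "2 * i + 1 < n" using that k by linarith
      then have "pos (2 * i + 1) \<in> idx" unfolding idx by blast
      then have "c (pos (2 * i) + 2 * e) = pos (2 * i + 1)"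
        using idx_c[of "pos (2 * i + 1)"] e1 by (simp add: pos_def algebra_simps)
      moreover have "pos (2 * i + 1) \<noteq> pos (2 * l)" for l by (simp add: pos_def) presburger
      ultimately show ?thesis by (auto simp: M0_def)
    qed
    moreover have "M0 \<subseteq> idx"
      unfolding idx M0_def using k by auto
    moreover have "card M0 = k"
      unfolding M0_def using card_image[OF inj2] by simp
    ultimately have marks: "M0 \<in> marks k"
      by (auto simp: marks_def M0_def)
    have less: "curve_weight n B i < curve_weight n B j" if i: "i \<in> M0" and j: "j \<in> idx - M0" for i j
    proof -
      obtain l where l: "l < k" "i = pos (2 * l)" using i unfolding M0_def by blast
      obtain r where r: "j = pos r" using j unfolding idx by blast
      then have "r \<notin> (\<lambda>i. 2 * i) ` {..<k}" using j unfolding M0_def by blast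
      then show ?thesis
        unfolding l(2) r weight using position_weight_less[OF n B k(2) l(1)] by blast
    qed
    have total: "sum (curve_weight n B) M0 = B ^ (2 * k + t)"
      unfolding M0_def using sum_position_weight_even[OF k] B
      by (simp add: sum.reindex[OF inj2] weight)
    have pos: "curve_weight n B j > 0" for j
      unfolding curve_weight_def by (rule position_weight_pos[OF n B])
    show ?thesis
      using curve_order[where w = "curve_weight n B", OF k(1) False marks pos less] unfolding total .
  qed
qed

end

section \<open>The variables of the invariants, and the conclusion\<close>

lemma pentagram_inv_polys_in:
  assumes n: "n > 0"
  shows "pentagram_inv n p k \<in> polys_in {1..2 * int n}"
proof -
  have units: "U \<subseteq> {1..2 * int n}" if "U \<in> units n p" for U
    using that cyc_in[OF n] by (auto simp: units_def)
  have "S \<subseteq> {1..2 * int n}" if "admissible n p S" for S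
    using that units by (auto simp: admissible_def unit_decomposition_def)
  moreover have "of_int i \<in> polys_in {1..2 * int n}" for i
  proof -
    have "(of_int i :: int cpoly) = Const (of_int i)"
      by (simp add: Const_def)
    then show ?thesis by (simp add: polys_in_Const)
  qed
  ultimately show ?thesis
    unfolding pentagram_inv_def
    by (auto intro!: polys_in_prod polys_in_sum polys_in_mult polys_in_Var)
qed

theorem theorem1p2:
  fixes n :: nat
  assumes "n \<ge> 3"
  shows "alg_independent (inv_indices n <+> inv_indices n)
           (case_sum (pentagram_O n) (pentagram_E n)) \<and>
         (\<exists>A \<subseteq> polys_in {1..2 * int n}.
            finite A \<and> card A \<ge> 2 * (n div 2) + 2 \<and>
            alg_independent A (\<lambda>f. f) \<and>
            (\<forall>f\<in>A. alpha_invariant n f))"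
proof -
  let ?I = "inv_indices n <+> inv_indices n"
  let ?f = "case_sum (pentagram_O n) (pentagram_E n)"
  interpret o: pentagram n odd 1 by (rule pentagram_odd) (use assms in simp_all)
  interpret e: pentagram n even 1 by (rule pentagram_even) (use assms in simp_all)
  have fin: "finite ?I" by (simp add: inv_indices_def)
  have ind: "alg_independent ?I ?f"
  \<comment> \<open>The orders are \<open>B ^ (2 * k)\<close> for the \<open>O\<close>-invariants
    and \<open>B ^ (2 * k + 1)\<close> for the \<open>E\<close>-invariants, so parity keeps the two
    families apart. The bound \<open>n + 2\<close> is the one under which the weights were
    estimated.\<close>
  proof (rule alg_independent_by_order[where N = "n + 2"
        and pos = "case_sum (\<lambda>k. 2 * k) (\<lambda>k. 2 * k + 1)"])
    show "finite ?I" by (rule fin)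
    show "inj_on (case_sum (\<lambda>k. 2 * k) (\<lambda>k. 2 * k + 1)) ?I"
      by (auto simp: inj_on_def split: sum.splits) presburger+
    fix B assume B: "n + 2 \<le> B"
    show "\<exists>w. \<forall>i\<in>?I. \<exists>g. subst (\<lambda>c. [:c:]) (\<lambda>j. monom 1 (w j)) (?f i) =
        monom 1 (B ^ case_sum (\<lambda>k. 2 * k) (\<lambda>k. 2 * k + 1) i) * g \<and> poly g 0 \<noteq> 0"
    proof (rule exI[of _ "curve_weight n B"], rule ballI)
      fix i assume "i \<in> ?I"
      then show "\<exists>g. subst (\<lambda>c. [:c:]) (\<lambda>j. monom 1 (curve_weight n B j)) (?f i) =
          monom 1 (B ^ case_sum (\<lambda>k. 2 * k) (\<lambda>k. 2 * k + 1) i) * g \<and> poly g 0 \<noteq> 0"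
        using o.pentagram_inv_order[OF refl _ B refl] e.pentagram_inv_order[OF refl _ B refl]
        by (elim PlusE) simp_all
    qed
  qed
  \<comment> \<open>Independence makes the members distinct, and each family has
    \<open>n div 2 + 1\<close> of them because \<open>n\<close> lies outside
    \<open>{1..n div 2}\<close>.\<close>
  have "card (?f ` ?I) = card ?I"
    by (rule card_image) (rule alg_independent_inj_on[OF ind])
  also have "\<dots> = 2 * (n div 2) + 2"
    using assms by (simp add: inv_indices_def card_Plus)
  finally have card: "card (?f ` ?I) = 2 * (n div 2) + 2" .
  have "?f ` ?I \<subseteq> polys_in {1..2 * int n}"
    using pentagram_inv_polys_in assms by auto
  moreover have "alpha_invariant n f" if "f \<in> ?f ` ?I" for f
    using that alpha_invariant_pentagram_inv[OF assms] assms by (auto simp: inv_indices_def)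
  ultimately show ?thesis
    using ind card alg_independent_image[OF ind] fin by (intro conjI exI[of _ "?f ` ?I"]) auto
qed

end
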